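(* Let $F$ be a forest on $n$ vertices $v_1,\dots,v_n$ and let $\vec{\lambda}=(\lambda_1,\dots,\lambda_n)$ be any sequence of non-negative integers. Then the bounded degree complex $\mathrm{BD}^{\vec{\lambda}}(F)$ is either contractible or homotopy equivalent to a wedge of spheres.
   Context: For a simple graph $G$ with vertex set $\{v_1,\dots,v_n\}$ and a sequence $\vec{\lambda}=(\lambda_1,\dots,\lambda_n)$ of non-negative integers, the bounded degree complex $\mathrm{BD}^{\vec{\lambda}}(G)$ is the simplicial complex whose vertices are the edges of $G$ and whose faces are the subsets $H\subseteq E(G)$ such that, for each $i$, the degree of $v_i$ in the subgraph of $G$ with edge set $H$ is at most $\lambda_i$. *)

theory Defs
  imports "HOL-Analysis.Analysis"
begin

definition simple_graph :: "'a set \<Rightarrow> 'a set set \<Rightarrow> bool" where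
  "simple_graph V E \<longleftrightarrow> finite V \<and> (\<forall>e\<in>E. e \<subseteq> V \<and> card e = 2)"

definition graph_cycle :: "'a set set \<Rightarrow> 'a list \<Rightarrow> bool" where
  "graph_cycle E vs \<longleftrightarrow> length vs \<ge> 3 \<and> distinct vs \<and>
     (\<forall>i < length vs. {vs ! i, vs ! (Suc i mod length vs)} \<in> E)"

definition forest_graph :: "'a set \<Rightarrow> 'a set set \<Rightarrow> bool" where
  "forest_graph V E \<longleftrightarrow> simple_graph V E \<and> \<not> (\<exists>vs. graph_cycle E vs)"

definition edge_degree :: "'a set set \<Rightarrow> 'a \<Rightarrow> nat" where
  "edge_degree H v = card {e \<in> H. v \<in> e}"

text \<open>A simplicial complex is given by its set of faces, including the empty face. An edge with an
  endpoint of bound 0 lies in no face.\<close>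

definition bounded_degree_complex :: "'a set \<Rightarrow> 'a set set \<Rightarrow> ('a \<Rightarrow> nat) \<Rightarrow> 'a set set set" where
  "bounded_degree_complex V E lam = {H. H \<subseteq> E \<and> (\<forall>v\<in>V. edge_degree H v \<le> lam v)}"

text \<open>Points are barycentric coordinates; the support is automatically finite, since a sum over an
  infinite set is 0. For a finite complex, the only case used here, the product topology induces
  the usual (coherent) topology; for infinite complexes it may be coarser.\<close>

definition geometric_realization :: "'v set set \<Rightarrow> ('v \<Rightarrow> real) topology" where
  "geometric_realization K =
     subtopology (powertop_real UNIV)
       {x. (\<forall>v. 0 \<le> x v) \<and> {v. x v \<noteq> 0} \<in> K \<and> (\<Sum>v | x v \<noteq> 0. x v) = 1}"

text \<open>The wedge of a nonempty family of pointed spaces \<open>(X i, p i)\<close> is the quotient of their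
  disjoint union that identifies all base points; \<open>None\<close> is the common base point.\<close>

definition wedge_proj :: "('i \<Rightarrow> 'a) \<Rightarrow> 'i \<times> 'a \<Rightarrow> ('i \<times> 'a) option" where
  "wedge_proj p z = (if snd z = p (fst z) then None else Some z)"

definition wedge_topology ::
    "('i \<Rightarrow> 'a topology) \<Rightarrow> ('i \<Rightarrow> 'a) \<Rightarrow> 'i set \<Rightarrow> ('i \<times> 'a) option topology" where
  "wedge_topology X p I =
     topology (\<lambda>U. U \<subseteq> wedge_proj p ` topspace (sum_topology X I) \<and>
       openin (sum_topology X I) {z \<in> topspace (sum_topology X I). wedge_proj p z \<in> U})"

lemma openin_wedge_topology:
  "openin (wedge_topology X p I) U \<longleftrightarrow>
     U \<subseteq> wedge_proj p ` topspace (sum_topology X I) \<and>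
     openin (sum_topology X I) {z \<in> topspace (sum_topology X I). wedge_proj p z \<in> U}"
proof -
  let ?S = "sum_topology X I"
  let ?pre = "\<lambda>U. {z \<in> topspace ?S. wedge_proj p z \<in> U}"
  have Int: "?pre (S \<inter> T) = ?pre S \<inter> ?pre T" for S T by blast
  have Un: "?pre (\<Union>K) = \<Union>(?pre ` K)" for K by blast
  have "istopology (\<lambda>U. U \<subseteq> wedge_proj p ` topspace ?S \<and> openin ?S (?pre U))"
    unfolding istopology_def
  proof (intro conjI allI impI)
    fix S T
    assume "S \<subseteq> wedge_proj p ` topspace ?S \<and> openin ?S (?pre S)"
      and "T \<subseteq> wedge_proj p ` topspace ?S \<and> openin ?S (?pre T)"
    then show "S \<inter> T \<subseteq> wedge_proj p ` topspace ?S" and "openin ?S (?pre (S \<inter> T))"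
      unfolding Int by (blast, intro openin_Int) blast+
  next
    fix K
    assume K: "\<forall>U\<in>K. U \<subseteq> wedge_proj p ` topspace ?S \<and> openin ?S (?pre U)"
    then show "\<Union>K \<subseteq> wedge_proj p ` topspace ?S"
      by blast
    show "openin ?S (?pre (\<Union>K))"
      unfolding Un by (rule openin_Union) (use K in blast)
  qed
  then show ?thesis
    unfolding wedge_topology_def by (simp only: topology_inverse')
qed

lemma topspace_wedge_topology:
  "topspace (wedge_topology X p I) = wedge_proj p ` topspace (sum_topology X I)"
proof -
  have "{z \<in> topspace (sum_topology X I).
           wedge_proj p z \<in> wedge_proj p ` topspace (sum_topology X I)} = topspace (sum_topology X I)"
    by blast
  then have "openin (wedge_topology X p I) (wedge_proj p ` topspace (sum_topology X I))"
    unfolding openin_wedge_topology by (simp del: topspace_sum_topology)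
  then have "wedge_proj p ` topspace (sum_topology X I) \<subseteq> topspace (wedge_topology X p I)"
    by (rule openin_subset)
  moreover have "openin (wedge_topology X p I) (topspace (wedge_topology X p I))" by (rule openin_topspace)
  ultimately show ?thesis
    unfolding openin_wedge_topology by (intro subset_antisym) auto
qed

lemma quotient_map_wedge_proj:
  "quotient_map (sum_topology X I) (wedge_topology X p I) (wedge_proj p)"
  unfolding quotient_map_def topspace_wedge_topology openin_wedge_topology by blast

lemma wedge_proj_eq_iff:
  "wedge_proj p (i, x) = wedge_proj p (j, y) \<longleftrightarrow> (i, x) = (j, y) \<or> x = p i \<and> y = p j"
  by (auto simp: wedge_proj_def)

definition sphere_base :: "nat \<Rightarrow> real" where
  "sphere_base j = (if j = 0 then 1 else 0)"

lemma sphere_base_in_nsphere: "sphere_base \<in> topspace (nsphere n)"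
  by (auto simp: nsphere sphere_base_def if_distrib[of "\<lambda>x. x ^ 2"] cong: if_cong)

definition wedge_of_spheres :: "nat \<Rightarrow> (nat \<Rightarrow> nat) \<Rightarrow> (nat \<times> (nat \<Rightarrow> real)) option topology" where
  "wedge_of_spheres k d = wedge_topology (\<lambda>i. nsphere (d i)) (\<lambda>i. sphere_base) {..<k}"

text \<open>The spheres may have different dimensions. The first disjunct is the sphere of dimension
  \<open>-1\<close>, that is, the empty space: it is the realization of the complex whose only face is the empty
  set, and it is not pointed, so it only occurs as a wedge with a single summand.\<close>

definition homotopy_equivalent_wedge_of_spheres :: "'a topology \<Rightarrow> bool" where
  "homotopy_equivalent_wedge_of_spheres X \<longleftrightarrow>
     X homotopy_equivalent_space (trivial_topology :: (nat \<Rightarrow> real) topology) \<or>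
     (\<exists>k d. k > 0 \<and> X homotopy_equivalent_space (wedge_of_spheres k d))"

text \<open>The library predicate \<open>contractible_space\<close> holds of the empty space.\<close>

definition nonempty_contractible_space :: "'a topology \<Rightarrow> bool" where
  "nonempty_contractible_space X \<longleftrightarrow> topspace X \<noteq> {} \<and> contractible_space X"

end

theory Submission
  imports Defs
begin

text \<open>Call a complex good if removing some of its facets leaves a collapsible complex. A forest with
  an edge has a vertex \<open>v\<close> all of whose edges, with at most one exception \<open>f\<close>, are leaf edges. If
  the bound at \<open>v\<close> is at least its degree, the bounded degree complex is a cone over a leaf edge at
  \<open>v\<close>; otherwise \<open>f\<close> is a shedding vertex, its deletion and link are bounded degree complexes of
  the forest without \<open>f\<close>, and goodness of both passes to the complex. So every bounded degree
  complex of a forest is good. The realization of a good complex is homotopy equivalent to its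
  quotient by the contractible subcomplex, and this quotient is a wedge with one sphere for every
  removed facet.\<close>

section \<open>Vertices of a forest next to its leaves\<close>

text \<open>Goodness does not record how the removed facets are attached: once the remainder is
  contractible, each of them becomes a sphere in the quotient, whatever its dimension. Removing no
  facet gives a contractible space; removing the empty face from \<open>{{}}\<close> gives the empty
  one. The combinatorial weight rests on shedding: a facet of the deletion must stay a facet when
  the cone over the link is glued on. This is an exchange argument. If \<open>f\<close> can be added
  to \<open>H\<close> although the bound at \<open>v\<close> is below the degree of
  \<open>v\<close>, then some leaf edge at \<open>v\<close> is still missing from \<open>H\<close>
  and can be added instead of \<open>f\<close>; its far end carries no other edge, so no bound is
  exceeded there. On the topological side, every homotopy is written in barycentric coordinates by
  means of the least coordinate over a face, a continuous function that vanishes on the boundary of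
  that face. Compactness of the realizations makes the maps in play quotient maps, including
  products with the interval.\<close>

definition graph_path :: "'a set set \<Rightarrow> 'a list \<Rightarrow> bool" where
  "graph_path E xs \<longleftrightarrow> distinct xs \<and> (\<forall>i. Suc i < length xs \<longrightarrow> {xs ! i, xs ! Suc i} \<in> E)"

lemma graph_path_ConsI:
  assumes "graph_path E (v # xs)" "{w, v} \<in> E" "w \<notin> set (v # xs)"
  shows "graph_path E (w # v # xs)"
  using assms unfolding graph_path_def
  by (auto simp: nth_Cons split: nat.splits)

lemma graph_path_ConsD: "graph_path E (v # xs) \<Longrightarrow> graph_path E xs"
  unfolding graph_path_def by fastforce

lemma graph_cycle_of_path:
  assumes p: "graph_path E xs" and j: "2 \<le> j" "j < length xs" and e: "{xs ! 0, xs ! j} \<in> E"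
  shows "graph_cycle E (take (Suc j) xs)"
  unfolding graph_cycle_def
proof (intro conjI allI impI)
  show "3 \<le> length (take (Suc j) xs)" "distinct (take (Suc j) xs)"
    using p j by (auto simp: graph_path_def)
  fix i assume "i < length (take (Suc j) xs)"
  then have i: "i \<le> j" using j by auto
  show "{take (Suc j) xs ! i, take (Suc j) xs ! (Suc i mod length (take (Suc j) xs))} \<in> E"
  proof (cases "i = j")
    case True
    then show ?thesis using j e by (simp add: insert_commute)
  next
    case False
    then show ?thesis using i j p by (auto simp: graph_path_def)
  qed
qed

text \<open>A neighbour of \<open>u\<close> off the path would prolong it, and one at position 2 or
  later would close a cycle; only \<open>v\<close> at position 1 remains.\<close>

lemma maximal_path_head_leaf:
  assumes F: "forest_graph V E" and p: "graph_path E (u # v # xs)"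
    and max: "\<And>ys. graph_path E ys \<Longrightarrow> length ys \<le> length (u # v # xs)"
    and e: "e \<in> E" "u \<in> e"
  shows "e = {u, v}"
proof -
  have "card e = 2" using F e by (auto simp: forest_graph_def simple_graph_def)
  then obtain w where w: "e = {u, w}" "w \<noteq> u"
    using e by (auto simp: card_2_iff)
  have "w \<in> set (u # v # xs)"
  proof (rule ccontr)
    assume n: "w \<notin> set (u # v # xs)"
    have "graph_path E (w # u # v # xs)"
      by (rule graph_path_ConsI) (use n p e w in \<open>auto simp: insert_commute\<close>)
    from max[OF this] show False by simp
  qed
  then obtain j where j: "j < length (u # v # xs)" "w = (u # v # xs) ! j"
    by (metis in_set_conv_nth)
  have "j \<noteq> 0" using j w by (metis nth_Cons_0)
  moreover have "\<not> 2 \<le> j"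
    using graph_cycle_of_path[OF p _ j(1)] F e(1) w(1) j(2) by (auto simp: forest_graph_def)
  ultimately have "j = 1" by simp
  then show ?thesis using j w by simp
qed

definition leaf_edge :: "'a set set \<Rightarrow> 'a \<Rightarrow> 'a set \<Rightarrow> bool" where
  "leaf_edge E v g \<longleftrightarrow> (\<exists>w\<in>g. w \<noteq> v \<and> (\<forall>e'\<in>E. w \<in> e' \<longrightarrow> e' = g))"

text \<open>Take a longest path \<open>u # v # ys\<close>. A neighbour of \<open>v\<close> other
  than \<open>hd ys\<close> can replace \<open>u\<close> at the head; the new path is again longest,
  so this neighbour is a leaf. The exception \<open>f\<close> is the edge along which the path
  continues.\<close>

lemma forest_near_leaf:
  assumes F: "forest_graph V E" and "E \<noteq> {}"
  obtains v e f where "e \<in> E" "v \<in> e" "f \<in> E" "v \<in> f"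
    "leaf_edge E v e" "\<forall>g\<in>E. v \<in> g \<longrightarrow> g \<noteq> f \<longrightarrow> leaf_edge E v g"
proof -
  have V: "finite V" and E: "\<And>e. e \<in> E \<Longrightarrow> e \<subseteq> V \<and> card e = 2"
    using F by (auto simp: forest_graph_def simple_graph_def)
  obtain e0 where e0: "e0 \<in> E" using assms by auto
  with E obtain a b where ab: "e0 = {a, b}" "a \<noteq> b" by (meson card_2_iff)
  have p0: "graph_path E [a, b]" using e0 ab by (auto simp: graph_path_def)
  have bound: "length xs \<le> Suc (card V)" if "graph_path E xs" for xs
  proof (cases xs)
    case (Cons x ys)
    \<comment> \<open>The vertex of a one-vertex path need not lie in \<open>V\<close>, but every
      later vertex of a path does, being an end of an edge. Hence the count over
      \<open>tl xs\<close> and the \<open>Suc\<close> in the bound.\<close>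
    have "set (tl xs) \<subseteq> V"
    proof
      fix y assume "y \<in> set (tl xs)"
      then obtain i where "i < length (tl xs)" "y = tl xs ! i" by (metis in_set_conv_nth)
      then have "Suc i < length xs" "y = xs ! Suc i" by (auto simp: nth_tl)
      then have "{xs ! i, y} \<in> E" using that by (auto simp: graph_path_def)
      then show "y \<in> V" using E by blast
    qed
    moreover have "distinct (tl xs)" using that by (auto simp: graph_path_def distinct_tl)
    ultimately have "length (tl xs) \<le> card V"
      using V by (metis card_mono distinct_card)
    then show ?thesis by simp
  qed simp
  obtain xs where xs: "graph_path E xs" and max: "\<And>ys. graph_path E ys \<Longrightarrow> length ys \<le> length xs"
    using ex_has_greatest_nat[of "graph_path E" "[a, b]" length "Suc (Suc (card V))"] p0 bound
    by (auto simp: less_Suc_eq_le)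
  have "length xs \<ge> 2" using max[OF p0] by simp
  then obtain u v ys where xs_eq: "xs = u # v # ys"
    by (metis One_nat_def Suc_1 length_Cons list.exhaust list.size(3) not_less_eq_eq nat.simps(3) le_zero_eq)
  have uv: "{u, v} \<in> E" "u \<noteq> v" using xs unfolding xs_eq graph_path_def by auto
  have leaf: "leaf_edge E v {v, w}"
    if w: "{v, w} \<in> E" "w \<noteq> v" "ys \<noteq> [] \<Longrightarrow> w \<noteq> hd ys" for w
  proof -
    have vys: "graph_path E (v # ys)" using xs unfolding xs_eq by (rule graph_path_ConsD)
    have "w \<notin> set (v # ys)"
    proof
      assume "w \<in> set (v # ys)"
      then obtain j where j: "j < length (v # ys)" "w = (v # ys) ! j"
        by (metis in_set_conv_nth)
      have "j \<noteq> 0" using j w by (metis nth_Cons_0)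
      moreover have "j \<noteq> 1" using j w by (auto simp: hd_conv_nth)
      ultimately have "2 \<le> j" by simp
      then show False
        using graph_cycle_of_path[OF vys _ j(1)] F w(1) j(2) by (auto simp: forest_graph_def)
    qed
    then have "graph_path E (w # v # ys)"
      using graph_path_ConsI[OF vys, of w] w by (auto simp: insert_commute)
    then have "\<And>e'. e' \<in> E \<Longrightarrow> w \<in> e' \<Longrightarrow> e' = {w, v}"
      using maximal_path_head_leaf[OF F] max xs_eq by (metis length_Cons)
    then show ?thesis using w(2) unfolding leaf_edge_def by (intro bexI[of _ w]) (simp_all add: insert_commute)
  qed
  have unth: "ys \<noteq> [] \<Longrightarrow> u \<noteq> hd ys" using xs unfolding xs_eq graph_path_def by auto
  \<comment> \<open>\<open>f\<close> has to be an edge at \<open>v\<close> even if there is no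
    exception; for \<open>ys = []\<close> the edge \<open>{u, v}\<close> fills the place and
    coincides with \<open>e\<close>.\<close>
  define f where "f = (if ys = [] then {u, v} else {v, hd ys})"
  show ?thesis
  proof (rule that[of "{u, v}" v f])
    show "f \<in> E" "v \<in> f"
      using uv xs unfolding f_def xs_eq graph_path_def
      by (auto simp: hd_conv_nth dest: spec[of _ 1])
    show "leaf_edge E v {u, v}"
      using leaf[of u] uv unth by (simp add: insert_commute)
    show "\<forall>g\<in>E. v \<in> g \<longrightarrow> g \<noteq> f \<longrightarrow> leaf_edge E v g"
    proof (intro ballI impI)
      fix g assume g: "g \<in> E" "v \<in> g" "g \<noteq> f"
      then obtain w where w: "g = {v, w}" "w \<noteq> v" using E[of g] by (auto simp: card_2_iff)
      show "leaf_edge E v g"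
        unfolding w(1) by (rule leaf) (use g w in \<open>auto simp: f_def\<close>)
    qed
  qed (use uv in auto)
qed

section \<open>Collapsing after removal of facets\<close>

text \<open>The collapse runs down to the void family: for a nonvoid simplicial complex the last
  pair consists of the empty face and a vertex. \<open>K\<close> need not be closed under subsets,
  which spares the combinatorial lemmas that side condition.\<close>

inductive collapsible :: "'v set set \<Rightarrow> bool" where
  collapsible_void: "collapsible {}"
| collapsible_step: "\<lbrakk>s \<in> K; v \<notin> s; insert v s \<in> K; \<And>r. r \<in> K \<Longrightarrow> s \<subseteq> r \<Longrightarrow> r = s \<or> r = insert v s;
     collapsible (K - {s, insert v s})\<rbrakk> \<Longrightarrow> collapsible K"

text \<open>\<open>M\<close> may be empty, and it may contain the empty face. The latter forces
  \<open>K = {{}}\<close> with void remainder, the case of the sphere of dimension -1.\<close>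

definition facet_collapsible :: "'v set set \<Rightarrow> bool" where
  "facet_collapsible K \<longleftrightarrow>
     (\<exists>M\<subseteq>K. (\<forall>s\<in>M. \<forall>r\<in>K. s \<subseteq> r \<longrightarrow> r = s) \<and> collapsible (K - M))"

text \<open>Pair each face \<open>s\<close> avoiding \<open>e\<close> with
  \<open>insert e s\<close>. If \<open>s\<close> is maximal among the faces avoiding
  \<open>e\<close>, its only proper coface is \<open>insert e s\<close>, and removing the pair
  preserves the cone conditions.\<close>

lemma collapsible_cone:
  assumes "finite K" "\<And>s. s \<in> K \<Longrightarrow> finite s"
    and "\<And>s. s \<in> K \<Longrightarrow> insert e s \<in> K" "\<And>s. s \<in> K \<Longrightarrow> s - {e} \<in> K"
  shows "collapsible K"
  using assms
proof (induction "card K" arbitrary: K rule: less_induct)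
  case less
  show ?case
  proof (cases "K = {}")
    case True
    then show ?thesis by (simp add: collapsible_void)
  next
    case False
    let ?D = "{s \<in> K. e \<notin> s}"
    have "finite ?D" "?D \<noteq> {}" using less.prems False by auto
    then obtain s where s: "s \<in> ?D" "\<And>r. r \<in> ?D \<Longrightarrow> s \<subseteq> r \<Longrightarrow> r = s"
      using finite_has_maximal[of ?D] by (metis (no_types, lifting))
    show ?thesis
    proof (rule collapsible_step[of s _ e])
      show "s \<in> K" "e \<notin> s" "insert e s \<in> K" using s less.prems by auto
      fix r assume r: "r \<in> K" "s \<subseteq> r"
      show "r = s \<or> r = insert e s"
      proof (cases "e \<in> r")
        case True
        then have "r - {e} = s" using s r less.prems(4)[of r] by auto
        then show ?thesis using True by auto
      qed (use s r in auto)
    next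
      have "card (K - {s, insert e s}) < card K"
        by (rule psubset_card_mono) (use s less.prems in auto)
      then show "collapsible (K - {s, insert e s})"
      proof (rule less.hyps)
        fix r assume r: "r \<in> K - {s, insert e s}"
        then have "insert e r \<noteq> s" "r - {e} \<noteq> insert e s" using s by auto
        moreover have "insert e r \<noteq> insert e s" using r s by (metis DiffE insertCI insert_absorb insert_ident mem_Collect_eq)
        moreover have "r - {e} \<noteq> s" using r s by (metis DiffE Diff_empty Diff_insert0 insertCI insert_Diff)
        ultimately show "insert e r \<in> K - {s, insert e s}" "r - {e} \<in> K - {s, insert e s}"
          using r less.prems by auto
      qed (use less.prems in auto)
    qed
  qed
qed

text \<open>Each collapse of \<open>L\<close> lifts by adding \<open>f\<close> to both faces of the
  pair; no member of \<open>D\<close> interferes, since none contains \<open>f\<close>. When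
  \<open>L\<close> is used up, only \<open>D\<close> is left.\<close>

lemma collapsible_Un_join_vertex:
  assumes "collapsible L" "collapsible D" "\<And>s. s \<in> L \<Longrightarrow> f \<notin> s" "\<And>s. s \<in> D \<Longrightarrow> f \<notin> s"
  shows "collapsible (D \<union> insert f ` L)"
  using assms
proof (induction L)
  case collapsible_void
  then show ?case by simp
next
  case (collapsible_step s L v)
  have fs: "f \<notin> s" "f \<noteq> v" using collapsible_step by auto
  have inj: "insert f r = insert f r' \<longleftrightarrow> r = r'" if "r \<in> L" "r' \<in> L" for r r'
    using that collapsible_step.prems(2) by (metis insert_ident)
  show ?case
  proof (rule collapsible.collapsible_step[of "insert f s" _ v])
    show "insert f s \<in> D \<union> insert f ` L" "v \<notin> insert f s" "insert v (insert f s) \<in> D \<union> insert f ` L"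
      using collapsible_step fs by (auto simp: insert_commute)
    fix r assume r: "r \<in> D \<union> insert f ` L" "insert f s \<subseteq> r"
    then obtain r' where r': "r' \<in> L" "r = insert f r'" using collapsible_step.prems(3) by blast
    then have "s \<subseteq> r'" using r fs by auto
    then show "r = insert f s \<or> r = insert v (insert f s)"
      using collapsible_step.hyps(4) r' by (auto simp: insert_commute)
  next
    have "insert f s \<notin> D" "insert f (insert v s) \<notin> D" using collapsible_step.prems(3) by auto
    then have "(D \<union> insert f ` L) - {insert f s, insert v (insert f s)}
        = D \<union> insert f ` (L - {s, insert v s})"
      using inj collapsible_step.hyps collapsible_step.prems(2,3)
      by (auto simp: insert_commute[of v f])
    then show "collapsible ((D \<union> insert f ` L) - {insert f s, insert v (insert f s)})"
      using collapsible_step by auto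
  qed
qed

text \<open>The hypothesis on maximal faces of \<open>D\<close> says that \<open>f\<close> is a shedding vertex.\<close>

lemma facet_collapsible_shedding:
  assumes D: "facet_collapsible D" and L: "facet_collapsible L"
    and f: "\<And>s. s \<in> L \<Longrightarrow> f \<notin> s" "\<And>s. s \<in> D \<Longrightarrow> f \<notin> s"
    and shed: "\<And>s. s \<in> D \<Longrightarrow> (\<And>r. r \<in> D \<Longrightarrow> s \<subseteq> r \<Longrightarrow> r = s) \<Longrightarrow> (\<And>r. r \<in> L \<Longrightarrow> \<not> s \<subseteq> r)"
  shows "facet_collapsible (D \<union> insert f ` L)"
proof -
  obtain A where A: "A \<subseteq> D" "\<forall>s\<in>A. \<forall>r\<in>D. s \<subseteq> r \<longrightarrow> r = s" "collapsible (D - A)"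
    using D unfolding facet_collapsible_def by auto
  obtain B where B: "B \<subseteq> L" "\<forall>s\<in>B. \<forall>r\<in>L. s \<subseteq> r \<longrightarrow> r = s" "collapsible (L - B)"
    using L unfolding facet_collapsible_def by auto
  have "(D \<union> insert f ` L) - (A \<union> insert f ` B) = (D - A) \<union> insert f ` (L - B)"
  proof -
    have "insert f ` L - insert f ` B = insert f ` (L - B)"
      by (rule inj_on_image_set_diff[symmetric, where C = L])
        (use B(1) f(1) in \<open>auto simp: inj_on_def insert_ident\<close>)
    moreover have "D \<inter> insert f ` B = {}" "insert f ` L \<inter> A = {}" using A(1) f(2) by auto
    moreover have "(D \<union> X) - (A \<union> Y) = (D - A) \<union> (X - Y)" if "D \<inter> Y = {}" "X \<inter> A = {}" for X Y
      using that by blast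
    ultimately show ?thesis by metis
  qed
  moreover have "collapsible \<dots>"
    by (rule collapsible_Un_join_vertex) (use A B f in auto)
  moreover have "r = s" if s: "s \<in> A \<union> insert f ` B" and r: "r \<in> D \<union> insert f ` L" "s \<subseteq> r" for s r
  proof (cases "s \<in> A")
    case True
    have "f \<notin> s" using True A f by auto
    \<comment> \<open>Shedding enters here: a facet of \<open>D\<close> avoids \<open>f\<close>, so
      it could only lie under \<open>insert f r'\<close> by lying under \<open>r'\<close>.\<close>
    then have "\<not> s \<subseteq> insert f r'" if "r' \<in> L" for r'
      using shed[of s r'] True A that by blast
    then show ?thesis using r True A by blast
  next
    case False
    then obtain s' where s': "s' \<in> B" "s = insert f s'" using s by auto
    then obtain r' where r': "r' \<in> L" "r = insert f r'" using r f by blast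
    have "s' \<subseteq> r'" using s' r' r f B by blast
    then show ?thesis using B s' r' by auto
  qed
  ultimately show ?thesis unfolding facet_collapsible_def
    using A(1) B(1) by (intro exI[of _ "A \<union> insert f ` B"]) auto
qed

section \<open>Bounded degree complexes of forests\<close>

lemma edge_degree_insert:
  "finite H \<Longrightarrow> f \<notin> H \<Longrightarrow> edge_degree (insert f H) v = edge_degree H v + (if v \<in> f then 1 else 0)"
proof -
  assume "finite H" "f \<notin> H"
  moreover have "{e \<in> insert f H. v \<in> e} = (if v \<in> f then insert f {e \<in> H. v \<in> e} else {e \<in> H. v \<in> e})"
    by auto
  ultimately show ?thesis unfolding edge_degree_def by simp
qed

lemma edge_degree_mono: "finite H \<Longrightarrow> H' \<subseteq> H \<Longrightarrow> edge_degree H' v \<le> edge_degree H v"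
  unfolding edge_degree_def by (rule card_mono) auto

lemma bounded_degree_complex_subset:
  assumes "finite E" "H \<in> bounded_degree_complex V E lam" "H' \<subseteq> H"
  shows "H' \<in> bounded_degree_complex V E lam"
proof -
  have "finite H" using assms finite_subset by (auto simp: bounded_degree_complex_def)
  then have "edge_degree H' v \<le> edge_degree H v" for v
    using assms(3) by (rule edge_degree_mono)
  then show ?thesis
    using assms unfolding bounded_degree_complex_def by (fastforce intro: le_trans)
qed

text \<open>Only the two ends of \<open>g\<close> gain degree. The end \<open>v\<close> is covered
  by \<open>deg\<close>; at the leaf \<open>w\<close> no other edge is available, so its degree is
  at most 1, which a positive bound permits.\<close>

lemma bounded_degree_complex_insert_leaf_edge:
  assumes F: "forest_graph V E" and pos: "\<forall>f\<in>E. \<forall>v\<in>f. lam v > 0"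
    and H: "H \<in> bounded_degree_complex V E lam"
    and g: "g \<in> E" "v \<in> g" "leaf_edge E v g"
    and deg: "edge_degree (insert g H) v \<le> lam v"
  shows "insert g H \<in> bounded_degree_complex V E lam"
proof -
  obtain w where w: "w \<in> g" "w \<noteq> v" "\<And>e. e \<in> E \<Longrightarrow> w \<in> e \<Longrightarrow> e = g"
    using g unfolding leaf_edge_def by blast
  have "card g = 2" using F g by (auto simp: forest_graph_def simple_graph_def)
  then have gw: "g = {v, w}" using g w(1,2) by (auto simp: card_2_iff)
  have HE: "H \<subseteq> E" and Hdeg: "\<And>x. x \<in> V \<Longrightarrow> edge_degree H x \<le> lam x"
    using H by (auto simp: bounded_degree_complex_def)
  have "edge_degree (insert g H) x \<le> lam x" if x: "x \<in> V" for x
  proof -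
    consider "x = v" | "x = w" | "x \<notin> g" using gw by auto
    then show ?thesis
    proof cases
      case 2
      have "{e \<in> insert g H. x \<in> e} \<subseteq> {g}"
        using HE w(3) 2 by blast
      then have "edge_degree (insert g H) x \<le> card {g}" unfolding edge_degree_def
        by (rule card_mono[rotated]) simp
      then show ?thesis using pos g(1) w(1) 2 by fastforce
    next
      case 3
      then have "{e \<in> insert g H. x \<in> e} = {e \<in> H. x \<in> e}" by auto
      then show ?thesis using Hdeg[OF x] by (simp add: edge_degree_def)
    qed (use deg in auto)
  qed
  then show ?thesis using HE g by (auto simp: bounded_degree_complex_def)
qed

text \<open>The induction on the number of edges leaves the bounds arbitrary, because passing to the
  link of \<open>f\<close> lowers them at the ends of \<open>f\<close>.\<close>

lemma facet_collapsible_bounded_degree_complex: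
  assumes "forest_graph V E"
  shows "facet_collapsible (bounded_degree_complex V E lam)"
  using assms
proof (induction "card E" arbitrary: E lam rule: less_induct)
  case less
  note F = less.prems
  let ?K = "bounded_degree_complex V E lam"
  have V: "finite V" and E: "\<And>e. e \<in> E \<Longrightarrow> e \<subseteq> V \<and> card e = 2"
    using F by (auto simp: forest_graph_def simple_graph_def)
  have "E \<subseteq> Pow V" using E by auto
  then have finE: "finite E" using V finite_subset by blast
  have finK: "finite ?K" "\<And>H. H \<in> ?K \<Longrightarrow> finite H"
    using finE by (auto simp: bounded_degree_complex_def intro: finite_subset)
  have IH: "facet_collapsible (bounded_degree_complex V (E - {f}) lam')" if "f \<in> E" for f lam'
  proof (rule less.hyps)
    show "card (E - {f}) < card E" using that finE by (rule card_Diff1_less[rotated])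
    show "forest_graph V (E - {f})" using F
      by (auto simp: forest_graph_def simple_graph_def graph_cycle_def)
  qed
  show ?case
  proof (cases "\<exists>f\<in>E. \<exists>v\<in>f. lam v = 0")
    case True
    then obtain f v where f: "f \<in> E" "v \<in> f" "lam v = 0" by blast
    have "f \<notin> H" if "H \<in> ?K" for H
    proof
      assume "f \<in> H"
      then have "edge_degree H v > 0" using f finK(2)[OF that]
        by (auto simp: edge_degree_def card_gt_0_iff)
      then show False using that f E[OF f(1)] by (fastforce simp: bounded_degree_complex_def)
    qed
    then have "?K = bounded_degree_complex V (E - {f}) lam"
      by (auto simp: bounded_degree_complex_def)
    then show ?thesis using IH[OF f(1)] by simp
  next
    case False
    then have pos: "\<forall>f\<in>E. \<forall>v\<in>f. lam v > 0" by auto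
    show ?thesis
    proof (cases "E = {}")
      case True
      \<comment> \<open>The empty face is itself a facet here, and removing it leaves the void
        family.\<close>
      then have "?K = {{}}" by (auto simp: bounded_degree_complex_def edge_degree_def)
      then show ?thesis unfolding facet_collapsible_def
        by (intro exI[of _ "{{}}"]) (simp add: collapsible_void)
    next
      case False
      obtain v e f where ef: "e \<in> E" "v \<in> e" "f \<in> E" "v \<in> f"
        and el: "leaf_edge E v e"
        and fl: "\<forall>g\<in>E. v \<in> g \<longrightarrow> g \<noteq> f \<longrightarrow> leaf_edge E v g"
        using forest_near_leaf[OF F False] .
      note add_leaf = bounded_degree_complex_insert_leaf_edge[OF F pos]
      note down = bounded_degree_complex_subset[OF finE]
      show ?thesis
      proof (cases "edge_degree E v \<le> lam v")
        case True
        have "collapsible ?K"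
        proof (rule collapsible_cone[where e = e])
          fix H assume H: "H \<in> ?K"
          then have "insert e H \<subseteq> E" using ef by (auto simp: bounded_degree_complex_def)
          then have "edge_degree (insert e H) v \<le> lam v"
            using edge_degree_mono[OF finE] True order_trans by blast
          then show "insert e H \<in> ?K" using add_leaf[OF H ef(1,2) el] by simp
          show "H - {e} \<in> ?K" using down[OF H] by auto
        qed (use finK in auto)
        then show ?thesis unfolding facet_collapsible_def by (intro exI[of _ "{}"]) simp
      next
        case big: False
        define D where "D = bounded_degree_complex V (E - {f}) lam"
        \<comment> \<open>In the link, \<open>f\<close> has already taken one from the bound at each
          of its ends. By \<open>pos\<close> the truncated subtraction is exact there.\<close>
        define L where "L = bounded_degree_complex V (E - {f}) (\<lambda>x. lam x - (if x \<in> f then 1 else 0))"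
        have link: "H \<in> L \<longleftrightarrow> f \<notin> H \<and> insert f H \<in> ?K" for H
        proof (cases "f \<notin> H \<and> H \<subseteq> E")
          case True
          then have "finite H" using finE finite_subset by auto
          moreover have "a \<le> lam x - (if x \<in> f then 1 else 0) \<longleftrightarrow> a + (if x \<in> f then 1 else 0) \<le> lam x"
            for a x using pos ef(3) by fastforce
          ultimately show ?thesis using True ef
            by (auto simp: L_def bounded_degree_complex_def edge_degree_insert)
        qed (auto simp: L_def bounded_degree_complex_def)
        have del: "H \<in> D \<longleftrightarrow> f \<notin> H \<and> H \<in> ?K" for H
          by (auto simp: D_def bounded_degree_complex_def)
        have "?K = D \<union> insert f ` L"
        proof (intro equalityI subsetI)
          fix H assume H: "H \<in> ?K"
          show "H \<in> D \<union> insert f ` L"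
          proof (cases "f \<in> H")
            case True
            then have "H - {f} \<in> L" using H link by (auto simp: insert_absorb)
            then show ?thesis using True by (metis UnI2 image_eqI insert_Diff)
          qed (use H del in auto)
        next
          fix H assume "H \<in> D \<union> insert f ` L"
          then show "H \<in> ?K" by (elim UnE imageE) (simp_all only: link del)
        qed
        moreover have "facet_collapsible (D \<union> insert f ` L)"
        proof (rule facet_collapsible_shedding)
          show "facet_collapsible D" "facet_collapsible L" using IH[OF ef(3)] by (auto simp: D_def L_def)
          fix H R assume H: "H \<in> D" and max: "\<And>R. R \<in> D \<Longrightarrow> H \<subseteq> R \<Longrightarrow> R = H" and R: "R \<in> L"
          show "\<not> H \<subseteq> R"
          proof
            \<comment> \<open>Since \<open>R\<close> lies in the link, \<open>f\<close> fits onto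
              \<open>H\<close>, so \<open>H\<close> has degree below \<open>lam v\<close> at
              \<open>v\<close>. As \<open>lam v\<close> is below the degree of \<open>v\<close> in
              \<open>E\<close>, an edge \<open>g\<close> at \<open>v\<close> lies outside
              \<open>insert f H\<close>; being a leaf edge it enlarges \<open>H\<close> within
              \<open>D\<close>, against maximality.\<close>
            assume "H \<subseteq> R"
            then have "insert f H \<subseteq> insert f R" by auto
            then have fH: "insert f H \<in> ?K" using down[of "insert f R"] R link by simp
            have H': "f \<notin> H" "H \<in> ?K" using H del by simp_all
            then have "finite H" using finK(2) by simp
            have "edge_degree (insert f H) v \<le> lam v"
              using fH ef(3,4) E[of f] by (auto simp: bounded_degree_complex_def)
            then have lt: "edge_degree H v < lam v"
              using edge_degree_insert[OF \<open>finite H\<close> H'(1)] ef(4) by simp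
            then have "edge_degree (insert f H) v < edge_degree E v"
              using big edge_degree_insert[OF \<open>finite H\<close> H'(1)] ef by auto
            moreover have "edge_degree E v \<le> edge_degree (insert f H) v"
              if "\<forall>g\<in>E. v \<in> g \<longrightarrow> g \<in> insert f H"
              unfolding edge_degree_def by (rule card_mono) (use \<open>finite H\<close> that in auto)
            ultimately obtain g where g: "g \<in> E" "v \<in> g" "g \<noteq> f" "g \<notin> H" by fastforce
            have "edge_degree (insert g H) v \<le> lam v"
              using edge_degree_insert[OF \<open>finite H\<close> g(4)] g lt by auto
            then have "insert g H \<in> ?K" using add_leaf[OF H'(2) g(1,2)] fl g(1-3) by simp
            then have "insert g H \<in> D" using del[of "insert g H"] g(3) H'(1) by simp
            from max[OF this] g(4) show False by auto
          qed
        qed (auto simp: link del)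
        ultimately show ?thesis by simp
      qed
    qed
  qed
qed

section \<open>Quotients by contractible subspaces and wedges\<close>

text \<open>Here \<open>q\<close> plays the quotient map from \<open>X\<close> to
  \<open>X/A\<close>, and \<open>h\<close> is a homotopy of \<open>X\<close> that keeps
  \<open>A\<close> inside itself and ends by shrinking \<open>A\<close> to a point. The final map of
  \<open>h\<close> factors through \<open>q\<close> and gives the inverse \<open>g\<close>; since
  \<open>h\<close> preserves \<open>A\<close>, it also descends to a homotopy on
  \<open>Q\<close>.\<close>

lemma homotopy_equivalent_space_collapse:
  fixes h :: "real \<times> 'a \<Rightarrow> 'a"
  assumes X: "compact_space X" and Q: "Hausdorff_space Q"
    and q: "continuous_map X Q q" "q ` topspace X = topspace Q"
    and A: "A \<subseteq> topspace X" "\<And>x y. x \<in> A \<Longrightarrow> y \<in> A \<Longrightarrow> q x = q y"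
    and inj: "\<And>x y. x \<in> topspace X \<Longrightarrow> y \<in> topspace X \<Longrightarrow> q x = q y \<Longrightarrow> x = y \<or> x \<in> A \<and> y \<in> A"
    and h: "continuous_map (prod_topology (top_of_set {0..1}) X) X h"
    and h0: "\<And>x. x \<in> topspace X \<Longrightarrow> h (0, x) = x"
    and hA: "\<And>t x. t \<in> {0..1} \<Longrightarrow> x \<in> A \<Longrightarrow> h (t, x) \<in> A"
    and h1: "\<And>x y. x \<in> A \<Longrightarrow> y \<in> A \<Longrightarrow> h (1, x) = h (1, y)"
  shows "X homotopy_equivalent_space Q"
proof -
  let ?I = "top_of_set {0..1::real}"
  have quot: "quotient_map X Q q"
    using continuous_imp_quotient_map[OF q(1) X Q q(2)] .
  have c1: "continuous_map X (prod_topology ?I X) (\<lambda>x. (1, x))"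
    by (auto intro!: continuous_intros)
  have ch1: "continuous_map X X (\<lambda>x. h (1, x))"
    using continuous_map_compose[OF c1 h] by (simp add: comp_def)
  obtain g where g: "continuous_map Q X g" "\<And>x. x \<in> topspace X \<Longrightarrow> g (q x) = h (1, x)"
    using quotient_map_lift_exists[OF quot ch1] inj h1 by metis
  let ?r = "\<lambda>p. (fst p, q (snd p))"
  \<comment> \<open>The product of a quotient map with the interval is again a quotient map here
    because it goes from a compact space onto a Hausdorff space.\<close>
  have r: "quotient_map (prod_topology ?I X) (prod_topology ?I Q) ?r"
  proof (rule continuous_imp_quotient_map)
    show "continuous_map (prod_topology ?I X) (prod_topology ?I Q) ?r"
      using q(1) by (intro continuous_map_pairedI continuous_map_fst continuous_map_compose[OF continuous_map_snd, unfolded comp_def])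
    show "compact_space (prod_topology ?I X)"
      using X by (simp add: compact_space_prod_topology compact_space_subtopology)
    show "Hausdorff_space (prod_topology ?I Q)"
      using Q by (simp add: Hausdorff_space_prod_topology Hausdorff_space_subtopology)
    show "?r ` topspace (prod_topology ?I X) = topspace (prod_topology ?I Q)"
      using q(2) by (force simp: image_iff)
  qed
  have qh: "continuous_map (prod_topology ?I X) Q (\<lambda>p. q (h p))"
    using continuous_map_compose[OF h q(1)] by (simp add: comp_def)
  have compat: "q (h p) = q (h p')"
    if pt: "p \<in> topspace (prod_topology ?I X)" "p' \<in> topspace (prod_topology ?I X)" and eq: "?r p = ?r p'" for p p'
  proof -
    obtain t x where p: "p = (t, x)" by (cases p)
    obtain x' where p': "p' = (t, x')" using eq p by (cases p') auto
    have "x = x' \<or> x \<in> A \<and> x' \<in> A" using pt eq inj[of x x'] p p' by auto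
    then show ?thesis
    proof
      assume "x \<in> A \<and> x' \<in> A"
      then have "h (t, x) \<in> A" "h (t, x') \<in> A" using hA[of t] pt(1) p by auto
      then show ?thesis unfolding p p' by (rule A(2))
    qed (simp add: p p')
  qed
  obtain H where H: "continuous_map (prod_topology ?I Q) Q H"
    "\<And>p. p \<in> topspace (prod_topology ?I X) \<Longrightarrow> H (?r p) = q (h p)"
    using quotient_map_lift_exists[OF r qh] compat by metis
  have Hq: "H (t, q x) = q (h (t, x))" if "t \<in> {0..1}" "x \<in> topspace X" for t x
    using H(2)[of "(t, x)"] that by simp
  have "homotopic_with (\<lambda>_. True) X X id (g \<circ> q)"
    using h h0 g(2) by (subst homotopic_with) auto
  moreover have "homotopic_with (\<lambda>_. True) Q Q id (q \<circ> g)"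
  proof (subst homotopic_with, simp, intro exI[of _ H] conjI ballI)
    fix y assume "y \<in> topspace Q"
    then obtain x where x: "x \<in> topspace X" "y = q x" using q(2) by auto
    show "H (0, y) = id y" "H (1, y) = (q \<circ> g) y"
      using Hq[of 0 x] Hq[of 1 x] x h0 g(2) by auto
  qed (use H in auto)
  ultimately show ?thesis
    unfolding homotopy_equivalent_space_def using q(1) g(1) homotopic_with_sym by metis
qed

lemma continuous_map_sum_topologyI:
  assumes f: "\<And>i. i \<in> I \<Longrightarrow> continuous_map (X i) Y (\<lambda>x. f (i, x))"
  shows "continuous_map (sum_topology X I) Y f"
  unfolding continuous_map_def
proof (intro conjI allI impI)
  show "f \<in> topspace (sum_topology X I) \<rightarrow> topspace Y"
    using f by (fastforce simp: continuous_map_def)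
  fix U assume U: "openin Y U"
  have "openin (X i) {x \<in> topspace (X i). f (i, x) \<in> U}" if "i \<in> I" for i
    using f[OF that] U by (simp add: continuous_map_def)
  moreover have "{x. (i, x) \<in> {z \<in> topspace (sum_topology X I). f z \<in> U}}
      = {x \<in> topspace (X i). f (i, x) \<in> U}" if "i \<in> I" for i using that by auto
  ultimately show "openin (sum_topology X I) {z \<in> topspace (sum_topology X I). f z \<in> U}"
    by (auto simp: openin_sum_topology)
qed

text \<open>The wedge maps injectively and continuously into the product of its summands: the
  component \<open>\<pi> i\<close> keeps the summand \<open>i\<close> and sends all others to the
  base point.\<close>

lemma Hausdorff_space_wedge_topology:
  assumes H: "\<And>i. i \<in> I \<Longrightarrow> Hausdorff_space (X i)" and p: "\<And>i. i \<in> I \<Longrightarrow> p i \<in> topspace (X i)"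
  shows "Hausdorff_space (wedge_topology X p I)"
proof -
  let ?W = "wedge_topology X p I" and ?S = "sum_topology X I"
  define \<pi> where "\<pi> i z = (case z of None \<Rightarrow> p i | Some (j, x) \<Rightarrow> if j = i then x else p i)" for i z
  have \<pi>: "continuous_map ?W (X i) (\<pi> i)" if i: "i \<in> I" for i
  proof (rule continuous_compose_quotient_map[OF quotient_map_wedge_proj])
    show "continuous_map ?S (X i) (\<pi> i \<circ> wedge_proj p)"
    proof (rule continuous_map_sum_topologyI)
      fix j assume "j \<in> I"
      have "(\<lambda>x. (\<pi> i \<circ> wedge_proj p) (j, x)) = (if j = i then (\<lambda>x. x) else (\<lambda>x. p i))"
        by (auto simp: \<pi>_def wedge_proj_def fun_eq_iff)
      then show "continuous_map (X j) (X i) (\<lambda>x. (\<pi> i \<circ> wedge_proj p) (j, x))"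
        using p[OF i] by simp
    qed
  qed
  let ?f = "\<lambda>z. \<lambda>i\<in>I. \<pi> i z"
  show ?thesis
  proof (rule Hausdorff_space_injective_preimage)
    show "continuous_map ?W (product_topology X I) ?f"
      using \<pi> by (auto simp: continuous_map_componentwise)
    show "Hausdorff_space (product_topology X I)"
      using H by (simp add: Hausdorff_space_product_topology)
    show "inj_on ?f (topspace ?W)"
    proof (rule inj_onI)
      fix y z assume y: "y \<in> topspace ?W" and z: "z \<in> topspace ?W" and eq: "?f y = ?f z"
      have "\<pi> i y = \<pi> i z" if "i \<in> I" for i using fun_cong[OF eq, of i] that by simp
      then show "y = z"
        using y z unfolding topspace_wedge_topology 
        by (force simp: \<pi>_def wedge_proj_def split: option.splits if_splits)
    qed
  qed
qed

section \<open>Realizations of simplicial complexes\<close>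

text \<open>The carrier of \<open>geometric_realization\<close> as a plain set, so that
  \<open>continuous_on\<close>, \<open>compact\<close> and \<open>contractible\<close>
  apply.\<close>

definition realization_set :: "'v set set \<Rightarrow> ('v \<Rightarrow> real) set" where
  "realization_set K = {x. (\<forall>v. 0 \<le> x v) \<and> {v. x v \<noteq> 0} \<in> K \<and> (\<Sum>v | x v \<noteq> 0. x v) = 1}"

definition closed_simplex :: "'v set \<Rightarrow> ('v \<Rightarrow> real) set" where
  "closed_simplex s = {x. (\<forall>v. 0 \<le> x v) \<and> (\<forall>v. v \<notin> s \<longrightarrow> x v = 0) \<and> (\<Sum>v\<in>s. x v) = 1}"

definition simplicial_complex :: "'v set set \<Rightarrow> bool" where
  "simplicial_complex K \<longleftrightarrow> finite K \<and> (\<forall>s\<in>K. finite s \<and> (\<forall>r\<subseteq>s. r \<in> K))"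

text \<open>On the closed simplex over a nonempty finite \<open>s\<close> this is zero exactly on
  the boundary. It measures depth continuously and drives the collapses, the extension of the
  contraction and the map to the sphere.\<close>

definition min_coord :: "'v set \<Rightarrow> ('v \<Rightarrow> real) \<Rightarrow> real" where
  "min_coord s x = Min (x ` s)"

lemma geometric_realization_eq: "geometric_realization K = top_of_set (realization_set K)"
  by (simp add: geometric_realization_def realization_set_def euclidean_product_topology)

lemma simplicial_complexD:
  assumes "simplicial_complex K" "s \<in> K"
  shows "finite s" "r \<subseteq> s \<Longrightarrow> r \<in> K"
  using assms by (auto simp: simplicial_complex_def)

lemma closed_simplex_iff:
  assumes "finite s"
  shows "x \<in> closed_simplex s \<longleftrightarrow>
    (\<forall>v. 0 \<le> x v) \<and> {v. x v \<noteq> 0} \<subseteq> s \<and> (\<Sum>v | x v \<noteq> 0. x v) = 1"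
proof -
  have "(\<Sum>v\<in>s. x v) = (\<Sum>v | x v \<noteq> 0. x v)" if "{v. x v \<noteq> 0} \<subseteq> s"
    by (rule sum.mono_neutral_right) (use assms that in auto)
  moreover have "{v. x v \<noteq> 0} \<subseteq> s \<longleftrightarrow> (\<forall>v. v \<notin> s \<longrightarrow> x v = 0)" by auto
  ultimately show ?thesis unfolding closed_simplex_def mem_Collect_eq by metis
qed

lemma closed_simplex_subset_realization:
  assumes "simplicial_complex K" "s \<in> K"
  shows "closed_simplex s \<subseteq> realization_set K"
  using closed_simplex_iff[OF simplicial_complexD(1)[OF assms]] simplicial_complexD(2)[OF assms]
  by (auto simp: realization_set_def)

lemma realization_in_closed_simplex:
  assumes "simplicial_complex K" "x \<in> realization_set K" "{v. x v \<noteq> 0} \<subseteq> s" "finite s"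
  shows "x \<in> closed_simplex s"
  using assms by (auto simp: closed_simplex_iff realization_set_def)

lemma realization_set_eq_Union:
  assumes "simplicial_complex K"
  shows "realization_set K = (\<Union>s\<in>K. closed_simplex s)"
proof -
  have "x \<in> closed_simplex {v. x v \<noteq> 0}" "{v. x v \<noteq> 0} \<in> K" if "x \<in> realization_set K" for x
  proof -
    show "{v. x v \<noteq> 0} \<in> K" using that by (simp add: realization_set_def)
    then show "x \<in> closed_simplex {v. x v \<noteq> 0}"
      using realization_in_closed_simplex[OF assms that subset_refl] simplicial_complexD(1)[OF assms] by simp
  qed
  then show ?thesis using closed_simplex_subset_realization[OF assms] by blast
qed

lemma closed_closed_simplex: "closed (closed_simplex s)"
proof -
  have c: "continuous_on UNIV (\<lambda>x::'a \<Rightarrow> real. x v)" for v by (rule continuous_on_product_coordinates)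
  have "closed_simplex s = (\<Inter>v. {x. 0 \<le> x v}) \<inter> (\<Inter>v\<in>-s. {x. x v = 0}) \<inter> {x. (\<Sum>v\<in>s. x v) = 1}"
    by (auto simp: closed_simplex_def)
  then show ?thesis
    by (simp only:) (intro closed_Int closed_INT ballI closed_Collect_le closed_Collect_eq continuous_intros c)
qed

text \<open>A closed subset of a cube, which is compact by Tychonoff even if the vertex type is
  infinite.\<close>

lemma compact_closed_simplex: "finite s \<Longrightarrow> compact (closed_simplex s)"
proof -
  assume s: "finite s"
  have "compactin (powertop_real UNIV) (PiE UNIV (\<lambda>_::'a. {0..1}))"
    by (simp add: compactin_PiE)
  then have "compact (PiE UNIV (\<lambda>_::'a. {0..1::real}))"
    by (simp add: euclidean_product_topology)
  moreover have "x v \<le> 1" if "x \<in> closed_simplex s" for x v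
  proof (cases "v \<in> s")
    case True
    then have "x v \<le> (\<Sum>v\<in>s. x v)"
      by (intro member_le_sum) (use that s in \<open>auto simp: closed_simplex_def\<close>)
    then show ?thesis using that by (simp add: closed_simplex_def)
  qed (use that in \<open>auto simp: closed_simplex_def\<close>)
  then have "closed_simplex s \<subseteq> PiE UNIV (\<lambda>_. {0..1})"
    by (auto simp: closed_simplex_def)
  ultimately show ?thesis
    using closed_closed_simplex compact_Int_closed by (metis inf.absorb_iff2)
qed

lemma compact_realization_set: "simplicial_complex K \<Longrightarrow> compact (realization_set K)"
  unfolding realization_set_eq_Union
  by (intro compact_UN) (auto simp: simplicial_complex_def compact_closed_simplex)

lemma continuous_on_min_coord:
  assumes "finite s" "s \<noteq> {}" and f: "\<And>v. v \<in> s \<Longrightarrow> continuous_on S (\<lambda>x. f x v)"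
  shows "continuous_on S (\<lambda>x. min_coord s (f x))"
  using assms
proof (induction s rule: finite_ne_induct)
  case (singleton v)
  then show ?case by (simp add: min_coord_def)
next
  case (insert v s)
  have "min_coord (insert v s) (f x) = min (f x v) (min_coord s (f x))" for x
    using insert.hyps by (simp add: min_coord_def)
  then show ?case using insert by (auto intro!: continuous_on_min)
qed

lemma min_coord_le: "finite s \<Longrightarrow> v \<in> s \<Longrightarrow> min_coord s x \<le> x v"
  by (simp add: min_coord_def)

lemma min_coord_attained: "finite s \<Longrightarrow> s \<noteq> {} \<Longrightarrow> \<exists>v\<in>s. x v = min_coord s x"
  using Min_in[of "x ` s"] unfolding min_coord_def by (metis finite_imageI imageE image_is_empty)

lemma min_coord_nonneg: "finite s \<Longrightarrow> s \<noteq> {} \<Longrightarrow> (\<And>v. 0 \<le> x v) \<Longrightarrow> 0 \<le> min_coord s x"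
  using min_coord_attained[of s x] by metis

lemma min_coord_eq_0:
  assumes "finite s" "s \<noteq> {}" "\<And>v. 0 \<le> x v" "\<not> s \<subseteq> {v. x v \<noteq> 0}"
  shows "min_coord s x = 0"
proof -
  obtain v where "v \<in> s" "x v = 0" using assms by auto
  then show ?thesis using min_coord_le[OF assms(1), of v x] min_coord_nonneg[of s x] assms by force
qed

lemma continuous_on_eval_snd [continuous_intros]:
  "continuous_on S (\<lambda>p. (snd p :: 'v \<Rightarrow> real) v)"
  by (rule continuous_on_product_then_coordinatewise) (intro continuous_intros)

text \<open>Push \<open>x\<close> from the free face \<open>s\<close> towards the vertex \<open>v\<close>, until a coordinate in \<open>s\<close> vanishes.\<close>

lemma realization_elementary_collapse:
  assumes K: "simplicial_complex K" and s: "s \<in> K" "s \<noteq> {}" "v \<notin> s" "insert v s \<in> K"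
    and free: "\<And>r. r \<in> K \<Longrightarrow> s \<subseteq> r \<Longrightarrow> r = s \<or> r = insert v s"
  shows "top_of_set (realization_set K) homotopy_equivalent_space
    top_of_set (realization_set (K - {s, insert v s}))"
proof -
  let ?R = "realization_set K" and ?R' = "realization_set (K - {s, insert v s})" and ?t = "insert v s"
  have fin: "finite s" "finite ?t" using simplicial_complexD[OF K] s by auto
  have sub: "?R' \<subseteq> ?R" by (auto simp: realization_set_def)
  \<comment> \<open>Every coordinate in \<open>s\<close> loses the same amount and \<open>v\<close>
    receives all of it, \<open>card s\<close> times that amount, so the coordinate sum stays
    1.\<close>
  define \<delta> :: "_ \<Rightarrow> real" where "\<delta> w = (if w = v then real (card s) else if w \<in> s then -1 else 0)" for w
  define h where "h p = (\<lambda>w. snd p w + fst p * min_coord s (snd p) * \<delta> w)" for p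
  have cont: "continuous_on S h" for S :: "(real \<times> ('a \<Rightarrow> real)) set"
    unfolding h_def
    by (intro continuous_on_coordinatewise_then_product continuous_intros continuous_on_min_coord fin s(2))
  have triv: "min_coord s x = 0 \<Longrightarrow> h (\<tau>, x) = x" for \<tau> x by (simp add: h_def)
  have zero: "min_coord s x = 0" if "x \<in> ?R" "\<not> s \<subseteq> {w. x w \<noteq> 0}" for x
    by (rule min_coord_eq_0) (use that fin s in \<open>auto simp: realization_set_def\<close>)
  have pushed: "h (\<tau>, x) \<in> closed_simplex ?t" if x: "x \<in> ?R" "s \<subseteq> {w. x w \<noteq> 0}" and \<tau>: "\<tau> \<in> {0..1}" for \<tau> x
  proof -
    have nn: "\<And>w. 0 \<le> x w" and "{w. x w \<noteq> 0} \<in> K" using x by (auto simp: realization_set_def)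
    then have "{w. x w \<noteq> 0} \<subseteq> ?t" using free[OF _ x(2)] by blast
    then have xt: "x \<in> closed_simplex ?t" using realization_in_closed_simplex[OF K x(1) _ fin(2)] by simp
    have m: "0 \<le> min_coord s x" using min_coord_nonneg[of s x] fin s nn by simp
    have "0 \<le> h (\<tau>, x) w" for w
    proof (cases "w \<in> s")
      case True
      have "\<tau> * min_coord s x \<le> 1 * x w"
        using min_coord_le[OF fin(1) True, of x] m \<tau> by (intro mult_mono) auto
      then show ?thesis using True s by (auto simp: h_def \<delta>_def)
    qed (use nn m \<tau> in \<open>auto simp: h_def \<delta>_def\<close>)
    moreover have "h (\<tau>, x) w = 0" if "w \<notin> ?t" for w
      using that xt by (auto simp: h_def \<delta>_def closed_simplex_def)
    moreover have "(\<Sum>w\<in>?t. h (\<tau>, x) w) = 1"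
    proof -
      have "(\<Sum>w\<in>s. \<delta> w) = (\<Sum>w\<in>s. -1)" by (rule sum.cong) (use s in \<open>auto simp: \<delta>_def\<close>)
      then have "(\<Sum>w\<in>?t. \<delta> w) = 0" using fin s by (simp add: \<delta>_def)
      moreover have "(\<Sum>w\<in>?t. h (\<tau>, x) w) = (\<Sum>w\<in>?t. x w) + \<tau> * min_coord s x * (\<Sum>w\<in>?t. \<delta> w)"
        unfolding h_def fst_conv snd_conv by (simp only: sum.distrib sum_distrib_left)
      ultimately show ?thesis using xt by (simp add: closed_simplex_def)
    qed
    ultimately show ?thesis by (simp add: closed_simplex_def)
  qed
  have hR: "h (\<tau>, x) \<in> ?R" if "x \<in> ?R" "\<tau> \<in> {0..1}" for \<tau> x
    using pushed[OF that(1) _ that(2)] closed_simplex_subset_realization[OF K s(4)] triv zero that by fastforce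
  have h1: "h (1, x) \<in> ?R'" if x: "x \<in> ?R" for x
  proof (cases "s \<subseteq> {w. x w \<noteq> 0}")
    case True
    \<comment> \<open>At time 1 the least coordinate over \<open>s\<close> has become 0, so the
      support no longer contains \<open>s\<close>.\<close>
    obtain w where w: "w \<in> s" "x w = min_coord s x" using min_coord_attained[OF fin(1) s(2)] by metis
    then have "h (1, x) w = 0" using s by (auto simp: h_def \<delta>_def)
    then have "{u. h (1, x) u \<noteq> 0} \<noteq> s" "{u. h (1, x) u \<noteq> 0} \<noteq> ?t" using w by auto
    then show ?thesis using hR[OF x, of 1] by (simp add: realization_set_def)
  next
    case False
    then have "{u. x u \<noteq> 0} \<noteq> s" "{u. x u \<noteq> 0} \<noteq> ?t" by auto
    then show ?thesis using x triv[OF zero[OF x False]] by (simp add: realization_set_def)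
  qed
  have fixed: "h (\<tau>, x) = x" if x: "x \<in> ?R'" for \<tau> x
  proof (rule triv[OF zero])
    show "x \<in> ?R" using x sub by blast
    have "{u. x u \<noteq> 0} \<in> K - {s, ?t}" using x by (simp add: realization_set_def)
    then show "\<not> s \<subseteq> {w. x w \<noteq> 0}" using free[of "{u. x u \<noteq> 0}"] by blast
  qed
  show ?thesis
  proof (rule deformation_retract_imp_homotopy_equivalent_space[of _ "\<lambda>x. h (1, x)"])
    have "homotopic_with_canon (\<lambda>_. True) ?R ?R id (\<lambda>x. h (1, x))"
    proof (subst homotopic_with, simp, intro exI[of _ h] conjI ballI)
      show "continuous_map (prod_topology (top_of_set {0..1}) (top_of_set ?R)) (top_of_set ?R) h"
        using cont hR by (auto simp: continuous_map_subtopology_eu)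
    qed (auto simp: h_def)
    then show "homotopic_with_canon (\<lambda>_. True) ?R ?R (\<lambda>x. h (1, x)) id"
      by (rule homotopic_with_symD)
    have "continuous_on ?R (\<lambda>x. h (1, x))"
      by (rule continuous_on_compose2[OF cont[of UNIV]]) (auto intro!: continuous_intros)
    then show "retraction_maps (top_of_set ?R) (top_of_set ?R') (\<lambda>x. h (1, x)) id"
      using h1 fixed sub by (auto simp: retraction_maps_def continuous_map_subtopology_eu)
  qed
qed

lemma simplicial_complex_collapse:
  assumes K: "simplicial_complex K" and free: "\<And>r. r \<in> K \<Longrightarrow> s \<subseteq> r \<Longrightarrow> r = s \<or> r = t" and "s \<subseteq> t"
  shows "simplicial_complex (K - {s, t})"
proof -
  have "r' \<in> K - {s, t}" if r: "r \<in> K - {s, t}" "r' \<subseteq> r" for r r'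
  proof -
    have "r' \<in> K" using simplicial_complexD(2)[OF K, of r r'] r by auto
    moreover have "\<not> s \<subseteq> r'" using free[of r] r by auto
    ultimately show ?thesis using assms(3) by auto
  qed
  then show ?thesis using K unfolding simplicial_complex_def by (meson Diff_iff finite_Diff)
qed

lemma simplicial_complex_Diff_facets:
  assumes K: "simplicial_complex K" and M: "\<And>s r. s \<in> M \<Longrightarrow> r \<in> K \<Longrightarrow> s \<subseteq> r \<Longrightarrow> r = s"
  shows "simplicial_complex (K - M)"
proof -
  have "r' \<in> K - M" if r: "r \<in> K - M" "r' \<subseteq> r" for r r'
    using simplicial_complexD(2)[OF K, of r r'] M[of r' r] r by auto
  then show ?thesis using K unfolding simplicial_complex_def by (meson Diff_iff finite_Diff)
qed

text \<open>If the empty face is the free one, freeness forces \<open>K = {{}, {v}}\<close>, whose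
  realization is a point. Otherwise the empty face survives the step, so the smaller complex is
  again nonvoid.\<close>

lemma contractible_realization_of_collapsible:
  assumes "collapsible K" "simplicial_complex K" "K \<noteq> {}"
  shows "contractible (realization_set K) \<and> realization_set K \<noteq> {}"
  using assms
proof (induction K)
  case (collapsible_step s K v)
  note K = collapsible_step.prems(1)
  let ?K' = "K - {s, insert v s}"
  show ?case
  proof (cases "s = {}")
    case True
    then have KK: "K = {{}, {v}}" using collapsible_step.hyps(1,3,4) by auto
    define e where "e w = (if w = v then 1 else 0 :: real)" for w
    have "closed_simplex {v} = {e}"
      by (auto simp: closed_simplex_def e_def fun_eq_iff)
    moreover have "closed_simplex {} = ({} :: ('a \<Rightarrow> real) set)" by (auto simp: closed_simplex_def)
    ultimately have "realization_set K = {e}"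
      using realization_set_eq_Union[OF K] KK by simp
    moreover have "contractible {e}"
      unfolding contractible_space_top_of_set[symmetric] by (rule contractible_space_subtopology_singleton)
    ultimately show ?thesis by simp
  next
    case False
    have "{} \<in> K" using simplicial_complexD(2)[OF K collapsible_step.hyps(1)] by blast
    then have "?K' \<noteq> {}" using False by auto
    moreover have "simplicial_complex ?K'"
      by (rule simplicial_complex_collapse[OF K]) (use collapsible_step.hyps(4) in auto)
    ultimately have IH: "contractible (realization_set ?K')" "realization_set ?K' \<noteq> {}"
      using collapsible_step.IH by auto
    have "top_of_set (realization_set K) homotopy_equivalent_space top_of_set (realization_set ?K')"
      using realization_elementary_collapse[OF K _ False] collapsible_step.hyps by blast
    then have "contractible (realization_set K)"
      using homotopy_equivalent_space_contractibility IH by (metis contractible_space_top_of_set)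
    moreover have "realization_set ?K' \<subseteq> realization_set K" by (auto simp: realization_set_def)
    ultimately show ?thesis using IH by auto
  qed
qed simp

text \<open>The homotopy extension property of \<open>|K - M| \<subseteq> |K|\<close>, with an explicit formula: points close to
  \<open>|K - M|\<close> are first pushed radially into it, and the contraction runs in the remaining time.\<close>

lemma realization_extend_contraction:
  fixes K :: "'v set set"
  assumes K: "simplicial_complex K" and M: "M \<subseteq> K" "{} \<notin> M"
    and facet: "\<And>s r. s \<in> M \<Longrightarrow> r \<in> K \<Longrightarrow> s \<subseteq> r \<Longrightarrow> r = s"
    and contr: "contractible (realization_set (K - M))"
  obtains h :: "real \<times> ('v \<Rightarrow> real) \<Rightarrow> 'v \<Rightarrow> real" and a where
    "continuous_on ({0..1} \<times> realization_set K) h"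
    "\<And>t x. t \<in> {0..1} \<Longrightarrow> x \<in> realization_set K \<Longrightarrow> h (t, x) \<in> realization_set K"
    "\<And>x. x \<in> realization_set K \<Longrightarrow> h (0, x) = x"
    "\<And>t x. t \<in> {0..1} \<Longrightarrow> x \<in> realization_set (K - M) \<Longrightarrow> h (t, x) \<in> realization_set (K - M)"
    "\<And>x. x \<in> realization_set (K - M) \<Longrightarrow> h (1, x) = a"
proof -
  let ?R = "realization_set K" and ?T = "realization_set (K - M)"
  have finM: "finite M" using K M(1) finite_subset by (auto simp: simplicial_complex_def)
  have fin: "finite s" "s \<noteq> {}" "card s > 0" if "s \<in> M" for s
    using that M simplicial_complexD(1)[OF K, of s] by (auto simp: card_gt_0_iff)
  obtain a c where c: "continuous_on ({0..1} \<times> ?T) c" "c ` ({0..1} \<times> ?T) \<subseteq> ?T"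
    "\<And>x. c (0, x) = x" "\<And>x. c (1::real, x) = a"
    using contr unfolding contractible_def homotopic_with_def
    by (auto simp: continuous_map_subtopology_eu image_subset_iff_funcset)
  \<comment> \<open>\<open>\<alpha> s\<close> is what every coordinate in \<open>s\<close> loses by
    time \<open>t\<close>. The cap \<open>t / (2 * card s)\<close> keeps the total loss at most 1/2,
    so the remaining mass \<open>N\<close>, by which \<open>z\<close> is rescaled, stays
    positive.\<close>
  define \<alpha> :: "'v set \<Rightarrow> real \<times> ('v \<Rightarrow> real) \<Rightarrow> real" where
    "\<alpha> s p = min (min_coord s (snd p)) (fst p / (2 * card s))" for s p
  define N where "N p = 1 - (\<Sum>s\<in>M. card s * \<alpha> s p)" for p
  define z where "z p w = (snd p w - (\<Sum>s\<in>M. if w \<in> s then \<alpha> s p else 0)) / N p" for p w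
  define m where "m p = (\<Sum>s\<in>M. card s * min_coord s (snd p))" for p :: "real \<times> ('v \<Rightarrow> real)"
  have nn: "0 \<le> x w" if "x \<in> ?R" for x w using that by (simp add: realization_set_def)
  have supp: "{w. x w \<noteq> 0} \<in> K" if "x \<in> ?R" for x using that by (simp add: realization_set_def)
  have T_iff: "x \<in> ?T \<longleftrightarrow> x \<in> ?R \<and> {w. x w \<noteq> 0} \<notin> M" for x by (auto simp: realization_set_def)
  have zero: "min_coord s x = 0" if "x \<in> ?R" "s \<in> M" "{w. x w \<noteq> 0} \<noteq> s" for x s
  proof (rule min_coord_eq_0)
    show "\<not> s \<subseteq> {w. x w \<noteq> 0}" using facet[OF that(2) supp[OF that(1)]] that(3) by auto
  qed (use fin[OF that(2)] nn[OF that(1)] in auto)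
  have \<alpha>_zero: "\<alpha> s (t, x) = 0" if "x \<in> ?R" "s \<in> M" "{w. x w \<noteq> 0} \<noteq> s" "0 \<le> t" for t x s
    using zero[OF that(1-3)] that(4) by (simp add: \<alpha>_def)
  have off: "z (t, x) = x" "N (t, x) = 1" "m (t, x) = 0" if "x \<in> ?T" "0 \<le> t" for t x
  proof -
    have x: "x \<in> ?R" "\<And>s. s \<in> M \<Longrightarrow> {w. x w \<noteq> 0} \<noteq> s" using that T_iff by auto
    show N: "N (t, x) = 1" unfolding N_def using \<alpha>_zero[OF x(1) _ x(2) that(2)] by simp
    show "m (t, x) = 0" unfolding m_def using zero[OF x(1) _ x(2)] by simp
    show "z (t, x) = x" unfolding z_def fun_eq_iff N using \<alpha>_zero[OF x(1) _ x(2) that(2)]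
      by (simp cong: sum.cong if_cong)
  qed
  \<comment> \<open>At a given point at most one facet of \<open>M\<close> contributes, namely the
    support. The sums over \<open>M\<close> in the definitions serve to make continuity
    immediate.\<close>
  have on: "N (t, x) = 1 - card s * \<alpha> s (t, x)" "m (t, x) = card s * min_coord s x"
    "z (t, x) w = (x w - (if w \<in> s then \<alpha> s (t, x) else 0)) / N (t, x)"
    if x: "x \<in> ?R" "{w. x w \<noteq> 0} = s" "s \<in> M" "0 \<le> t" for t x s w
  proof -
    have single: "(\<Sum>r\<in>M. f r) = f s" if "\<And>r. r \<in> M \<Longrightarrow> r \<noteq> s \<Longrightarrow> f r = 0" for f :: "'v set \<Rightarrow> real"
      using sum.remove[OF finM x(3), of f] that by simp
    have \<alpha>0: "\<alpha> r (t, x) = 0" if "r \<in> M" "r \<noteq> s" for r using \<alpha>_zero[OF x(1) that(1)] that(2) x by auto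
    have m0: "min_coord r x = 0" if "r \<in> M" "r \<noteq> s" for r using zero[OF x(1) that(1)] that(2) x by auto
    show "N (t, x) = 1 - card s * \<alpha> s (t, x)"
      unfolding N_def by (subst single) (simp_all add: \<alpha>0)
    show "m (t, x) = card s * min_coord s x"
      unfolding m_def by (subst single) (simp_all add: m0)
    show "z (t, x) w = (x w - (if w \<in> s then \<alpha> s (t, x) else 0)) / N (t, x)"
      unfolding z_def by (subst single) (simp_all add: \<alpha>0)
  qed
  have \<alpha>_bounds: "0 \<le> \<alpha> s (t, x)" "card s * \<alpha> s (t, x) \<le> 1/2"
    if "x \<in> ?R" "s \<in> M" "t \<in> {0..1}" for t x s
  proof -
    show "0 \<le> \<alpha> s (t, x)"
      using min_coord_nonneg[of s x] fin[OF that(2)] nn[OF that(1)] that(3) by (simp add: \<alpha>_def)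
    have "card s * \<alpha> s (t, x) \<le> card s * (t / (2 * card s))"
      by (rule mult_left_mono) (auto simp: \<alpha>_def)
    also have "\<dots> \<le> 1/2" using fin[OF that(2)] that(3) by (simp add: field_simps)
    finally show "card s * \<alpha> s (t, x) \<le> 1/2" .
  qed
  have Npos: "N (t, x) > 0" if "x \<in> ?R" "t \<in> {0..1}" for t x
  proof (cases "{w. x w \<noteq> 0} \<in> M")
    case True
    then show ?thesis using on(1)[OF that(1) refl True, of t] \<alpha>_bounds(2)[OF that(1) True that(2)] that(2) by simp
  next
    case False
    then show ?thesis using off(2)[of x t] that T_iff by simp
  qed
  have zR: "z (t, x) \<in> ?R" if x: "x \<in> ?R" and t: "t \<in> {0..1}" for t x
  proof (cases "{w. x w \<noteq> 0} \<in> M")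
    case True
    define s where "s = {w. x w \<noteq> 0}"
    have s: "s \<in> M" "{w. x w \<noteq> 0} = s" using True by (auto simp: s_def)
    note z_eq = on(3)[OF x s(2,1), of t] and N_eq = on(1)[OF x s(2,1), of t]
    have xs: "x \<in> closed_simplex s"
      using realization_in_closed_simplex[OF K x] s fin(1)[OF s(1)] by simp
    have "0 \<le> z (t, x) w" for w
    proof -
      have "\<alpha> s (t, x) \<le> x w" if "w \<in> s"
        using min_coord_le[OF fin(1)[OF s(1)] that, of x] by (auto simp: \<alpha>_def)
      then show ?thesis using z_eq[of w] Npos[OF x t] nn[OF x, of w] t by simp
    qed
    moreover have "z (t, x) w = 0" if "w \<notin> s" for w
      using z_eq[of w] that t xs by (simp add: closed_simplex_def)
    moreover have "(\<Sum>w\<in>s. z (t, x) w) = 1"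
    proof -
      have "(\<Sum>w\<in>s. z (t, x) w) = (\<Sum>w\<in>s. (x w - \<alpha> s (t, x)) / N (t, x))"
        by (rule sum.cong) (use z_eq t in auto)
      also have "\<dots> = ((\<Sum>w\<in>s. x w) - card s * \<alpha> s (t, x)) / N (t, x)"
        by (simp add: sum_divide_distrib[symmetric] sum_subtractf)
      also have "\<dots> = 1" using xs N_eq t Npos[OF x t] by (simp add: closed_simplex_def)
      finally show ?thesis .
    qed
    ultimately have "z (t, x) \<in> closed_simplex s" by (simp add: closed_simplex_def)
    then show ?thesis using closed_simplex_subset_realization[OF K] s M by blast
  next
    case False
    then show ?thesis using off(1)[of x t] x t T_iff by simp
  qed
  have m_nonneg: "0 \<le> m (t, x)" if x: "x \<in> ?R" for t x
    unfolding m_def using min_coord_nonneg[of _ x] fin nn[OF x] by (auto intro!: sum_nonneg mult_nonneg_nonneg)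
  have zT: "z (t, x) \<in> ?T" if x: "x \<in> ?R" and t: "t \<in> {0..1}" and le: "2 * m (t, x) \<le> t" for t x
  proof (cases "{w. x w \<noteq> 0} \<in> M")
    case True
    define s where "s = {w. x w \<noteq> 0}"
    have s: "s \<in> M" "{w. x w \<noteq> 0} = s" using True by (auto simp: s_def)
    have t0: "0 \<le> t" using t by simp
    have "2 * (card s * min_coord s x) \<le> t" using le on(2)[OF x s(2,1) t0] by simp
    \<comment> \<open>From time \<open>2 * m\<close> on the cap is no longer active, the least
      coordinate is cancelled completely, and the point has reached the boundary of its
      facet.\<close>
    then have \<alpha>: "\<alpha> s (t, x) = min_coord s x" using fin[OF s(1)] by (simp add: \<alpha>_def field_simps min_def)
    obtain w where w: "w \<in> s" "x w = min_coord s x"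
      using min_coord_attained[of s x] fin[OF s(1)] by auto
    have "z (t, x) w = 0" using on(3)[OF x s(2,1) t0, of w] w \<alpha> by simp
    moreover have "z (t, x) w = 0" if "w \<notin> s" for w
      using on(3)[OF x s(2,1) t0, of w] that s by auto
    ultimately have sub: "{u. z (t, x) u \<noteq> 0} \<subset> s" using w(1) by auto
    have "{u. z (t, x) u \<noteq> 0} \<notin> M"
    proof
      assume "{u. z (t, x) u \<noteq> 0} \<in> M"
      from facet[OF this, of s] sub s M show False by auto
    qed
    then show ?thesis using T_iff zR[OF x t] by simp
  next
    case False
    then show ?thesis using off(1)[of x t] x t T_iff by simp
  qed
  have cont_min: "continuous_on S (\<lambda>p. min_coord s (snd p))" if "s \<in> M"
    for s and S :: "(real \<times> ('v \<Rightarrow> real)) set"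
    by (intro continuous_on_min_coord continuous_intros fin that)
  have cont_\<alpha>: "continuous_on S (\<alpha> s)" if "s \<in> M" for s and S :: "(real \<times> ('v \<Rightarrow> real)) set"
    unfolding \<alpha>_def using fin[OF that]
    by (intro continuous_on_min cont_min[OF that] continuous_intros) auto
  have cont_N: "continuous_on S N" for S
    unfolding N_def by (intro continuous_intros cont_\<alpha>)
  have cont_m: "continuous_on S m" for S
    unfolding m_def by (intro continuous_intros cont_min)
  have cont_z: "continuous_on ({0..1} \<times> ?R) z"
  proof (rule continuous_on_coordinatewise_then_product)
    fix w
    have "continuous_on S (\<lambda>p. if w \<in> s then \<alpha> s p else 0)" if "s \<in> M" for s S
      using cont_\<alpha>[OF that] by (cases "w \<in> s") auto
    then show "continuous_on ({0..1} \<times> ?R) (\<lambda>p. z p w)"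
      unfolding z_def using Npos by (intro continuous_intros cont_N) force+
  qed
  \<comment> \<open>The clock of the contraction \<open>c\<close> starts at time
    \<open>2 * m\<close>, when the pushed point arrives in \<open>?T\<close>. Both branches agree at
    that moment because \<open>c\<close> is the identity at time 0. On \<open>?T\<close> itself
    \<open>m\<close> vanishes and \<open>h\<close> is \<open>c\<close>.\<close>
  define h where "h p = (if 2 * m p - fst p \<le> 0 then c (fst p - 2 * m p, z p) else z p)" for p
  show ?thesis
  proof (rule that[of h a])
    show "continuous_on ({0..1} \<times> ?R) h"
      unfolding h_def
    proof (rule continuous_on_cases_le)
      let ?S = "{p \<in> {0..1} \<times> ?R. 2 * m p - fst p \<le> 0}"
      have zS: "continuous_on ?S z" by (rule continuous_on_subset[OF cont_z]) auto
      show "continuous_on ?S (\<lambda>p. c (fst p - 2 * m p, z p))"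
      proof (rule continuous_on_compose2[OF c(1)])
        show "continuous_on ?S (\<lambda>p. (fst p - 2 * m p, z p))"
          by (intro continuous_intros cont_m zS)
        show "(\<lambda>p. (fst p - 2 * m p, z p)) ` ?S \<subseteq> {0..1} \<times> ?T"
        proof
          fix y assume "y \<in> (\<lambda>p. (fst p - 2 * m p, z p)) ` ?S"
          then obtain t x where tx: "t \<in> {0..1}" "x \<in> ?R" "2 * m (t, x) - t \<le> 0"
            and y: "y = (t - 2 * m (t, x), z (t, x))" by auto
          show "y \<in> {0..1} \<times> ?T"
            using zT[OF tx(2,1)] m_nonneg[OF tx(2), of t] tx unfolding y by simp
        qed
      qed
      show "continuous_on {p \<in> {0..1} \<times> ?R. 0 \<le> 2 * m p - fst p} z"
        by (rule continuous_on_subset[OF cont_z]) auto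
      show "continuous_on ({0..1} \<times> ?R) (\<lambda>p. 2 * m p - fst p)"
        by (intro continuous_intros cont_m)
    qed (simp add: c(3))
    have cT: "c (t, y) \<in> ?T" if "t \<in> {0..1}" "y \<in> ?T" for t y using c(2) that by blast
    show "h (t, x) \<in> ?R" if "t \<in> {0..1}" "x \<in> ?R" for t x
    proof (cases "2 * m (t, x) - t \<le> 0")
      case True
      then have "c (t - 2 * m (t, x), z (t, x)) \<in> ?T"
        using cT zT[OF that(2,1)] m_nonneg[OF that(2), of t] that(1) by auto
      then show ?thesis using True T_iff by (simp add: h_def)
    qed (use zR[OF that(2,1)] in \<open>simp add: h_def\<close>)
    show "h (0, x) = x" if x: "x \<in> ?R" for x
    proof -
      have "\<alpha> s (0, x) = 0" if "s \<in> M" for s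
        using min_coord_nonneg[of s x] fin[OF that] nn[OF x] by (simp add: \<alpha>_def)
      then have "z (0, x) = x" unfolding z_def N_def fun_eq_iff by (simp cong: sum.cong if_cong)
      then show ?thesis using m_nonneg[OF x, of 0] by (auto simp: h_def c(3))
    qed
    have hT: "h (t, x) = c (t, x)" if "t \<in> {0..1}" "x \<in> ?T" for t x
      using off[OF that(2), of t] that(1) by (simp add: h_def)
    show "h (t, x) \<in> ?T" if "t \<in> {0..1}" "x \<in> ?T" for t x
      using hT[OF that] cT[OF that] by simp
    show "h (1, x) = a" if "x \<in> ?T" for x using hT[of 1 x] that c(4) by simp
  qed
qed

section \<open>Collapsing the boundary of a simplex\<close>

text \<open>A relative homeomorphism from the simplex modulo its boundary to a pointed sphere.
  Displacement from the barycentre, divided by a depth that is 0 on the boundary, spreads the open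
  simplex over a Euclidean space, and the base point of the sphere is the point at infinity. For
  \<open>card s = 1\<close> the boundary is empty and the base point is not attained.\<close>

lemma closed_simplex_to_sphere:
  fixes s :: "'v set"
  assumes s: "finite s" "s \<noteq> {}"
  obtains \<phi> :: "('v \<Rightarrow> real) \<Rightarrow> nat \<Rightarrow> real" where
    "continuous_on (closed_simplex s) \<phi>"
    "\<And>x. x \<in> closed_simplex s \<Longrightarrow> \<phi> x \<in> topspace (nsphere (card s - 1))"
    "\<And>x. x \<in> closed_simplex s \<Longrightarrow> \<phi> x = sphere_base \<longleftrightarrow> {v. x v \<noteq> 0} \<noteq> s"
    "\<And>x y. x \<in> closed_simplex s \<Longrightarrow> y \<in> closed_simplex s \<Longrightarrow> {v. x v \<noteq> 0} = s \<Longrightarrow> {v. y v \<noteq> 0} = s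
       \<Longrightarrow> \<phi> x = \<phi> y \<Longrightarrow> x = y"
    "\<And>p. p \<in> topspace (nsphere (card s - 1)) \<Longrightarrow> p \<noteq> sphere_base
       \<Longrightarrow> \<exists>x\<in>closed_simplex s. {v. x v \<noteq> 0} = s \<and> \<phi> x = p"
proof -
  define n where "n = card s"
  have n: "n > 0" using s by (simp add: n_def card_gt_0_iff)
  obtain e where e: "bij_betw e {..<n} s"
    using ex_bij_betw_nat_finite[OF s(1)] by (auto simp: n_def atLeast0LessThan)
  have e_in: "e j \<in> s" if "j < n" for j using e that by (auto simp: bij_betw_def)
  have e_ex: "\<exists>j<n. v = e j" if "v \<in> s" for v using e that by (auto simp: bij_betw_def)
  have split: "{..<n} = insert 0 {1..<n}" "{..n - 1} = insert 0 {1..<n}" using n by auto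
  \<comment> \<open>\<open>m\<close> is the depth, scaled to be 1 at the barycentre;
    \<open>S\<close> omits coordinate 0, which \<open>W_sum\<close> recovers. Clearing the
    denominator \<open>m\<close> in the stereographic formula lets \<open>\<phi>\<close> extend
    continuously to the boundary.\<close>
  define m where "m x = n * min_coord s x" for x
  define W where "W x j = x (e j) - 1 / n" for x :: "'v \<Rightarrow> real" and j
  define S where "S x = (\<Sum>j\<in>{1..<n}. (W x j)\<^sup>2)" for x
  define \<phi> where "\<phi> x j = (if j = 0 then (S x - (m x)\<^sup>2) / (S x + (m x)\<^sup>2)
     else if j < n then 2 * m x * W x j / (S x + (m x)\<^sup>2) else 0)" for x j
  have nn: "0 \<le> x v" if "x \<in> closed_simplex s" for x v using that by (simp add: closed_simplex_def)
  have W_sum: "W x 0 = - (\<Sum>j\<in>{1..<n}. W x j)" if "x \<in> closed_simplex s" for x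
  proof -
    have "(\<Sum>j<n. x (e j)) = (\<Sum>v\<in>s. x v)" using sum.reindex_bij_betw[OF e, of x] .
    then have "(\<Sum>j<n. W x j) = 0" using that n by (simp add: W_def sum_subtractf closed_simplex_def)
    then show ?thesis unfolding split by simp
  qed
  have W_ext: "x = y" if x: "x \<in> closed_simplex s" "y \<in> closed_simplex s" and W: "\<And>j. j < n \<Longrightarrow> W x j = W y j" for x y
  proof
    fix v
    show "x v = y v"
    proof (cases "v \<in> s")
      case True
      then show ?thesis using e_ex W by (fastforce simp: W_def)
    qed (use x in \<open>simp add: closed_simplex_def\<close>)
  qed
  have m_nonneg: "0 \<le> m x" if "x \<in> closed_simplex s" for x
    using min_coord_nonneg[OF s nn[OF that]] by (simp add: m_def)
  \<comment> \<open>Together with \<open>m_att\<close>: \<open>m x - 1\<close> is the least of the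
    numbers \<open>n * W x j\<close>, so \<open>m\<close> can be read off from
    \<open>W\<close>.\<close>
  have m_le: "m x - 1 \<le> n * W x j" if "j < n" for x j
  proof -
    have "min_coord s x \<le> x (e j)" using min_coord_le[OF s(1) e_in[OF that]] .
    then have "n * min_coord s x \<le> n * x (e j)" by (simp add: n)
    then show ?thesis using n by (simp add: m_def W_def right_diff_distrib)
  qed
  have m_att: "\<exists>j<n. m x - 1 = n * W x j" for x
  proof -
    obtain v where "v \<in> s" "x v = min_coord s x" using min_coord_attained[OF s] by metis
    then obtain j where "j < n" "x (e j) = min_coord s x" using e_ex by metis
    then show ?thesis using n by (auto simp: m_def W_def right_diff_distrib)
  qed
  \<comment> \<open>If \<open>S\<close> and \<open>m\<close> both vanished, all \<open>W x j\<close>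
    would be 0, and \<open>m_att\<close> would give \<open>m x = 1\<close>.\<close>
  have D: "S x + (m x)\<^sup>2 > 0" if x: "x \<in> closed_simplex s" for x
  proof (rule ccontr)
    have S0: "0 \<le> S x" unfolding S_def by (intro sum_nonneg) auto
    assume "\<not> ?thesis"
    then have "S x = 0" and m0: "m x = 0" using S0 by (smt (verit) zero_le_power2 power2_eq_iff_nonneg zero_eq_power2)+
    then have W1: "W x j = 0" if "j \<in> {1..<n}" for j
      using that unfolding S_def by (simp add: sum_nonneg_eq_0_iff)
    then have "W x 0 = 0" using W_sum[OF x] by simp
    then have "W x j = 0" if "j < n" for j using W1[of j] that by (cases "j = 0") auto
    then show False using m_att[of x] m0 by auto
  qed
  have m_pos: "m x > 0 \<longleftrightarrow> {v. x v \<noteq> 0} = s" if x: "x \<in> closed_simplex s" for x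
  proof -
    have sub: "{v. x v \<noteq> 0} \<subseteq> s" using x by (auto simp: closed_simplex_def)
    show ?thesis
    proof (cases "{v. x v \<noteq> 0} = s")
      case True
      obtain v where "v \<in> s" "x v = min_coord s x" using min_coord_attained[OF s] by metis
      then have "min_coord s x > 0" using True nn[OF x, of v] by force
      then show ?thesis using True n by (simp add: m_def)
    next
      case False
      then have "\<not> s \<subseteq> {v. x v \<noteq> 0}" using sub by auto
      then have "min_coord s x = 0" using min_coord_eq_0[OF s nn[OF x]] by simp
      then show ?thesis using False by (simp add: m_def)
    qed
  qed
  have one_minus: "1 - \<phi> x 0 = 2 * (m x)\<^sup>2 / (S x + (m x)\<^sup>2)" if "x \<in> closed_simplex s" for x
    using D[OF that] by (simp add: \<phi>_def field_simps)
  show ?thesis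
  proof (rule that[of \<phi>])
    have cx: "continuous_on A (\<lambda>x. x v)" for A :: "('v \<Rightarrow> real) set" and v
      by (rule continuous_on_subset[OF continuous_on_product_coordinates]) auto
    have cm: "continuous_on A m" for A :: "('v \<Rightarrow> real) set"
      unfolding m_def by (intro continuous_intros continuous_on_min_coord s cx)
    have cW: "continuous_on A (\<lambda>x. W x j)" for A :: "('v \<Rightarrow> real) set" and j
      unfolding W_def by (intro continuous_intros cx)
    have cS: "continuous_on A S" for A :: "('v \<Rightarrow> real) set"
      unfolding S_def by (intro continuous_intros cW)
    have D': "\<forall>x\<in>closed_simplex s. S x + (m x)\<^sup>2 \<noteq> 0" using D by force
    show "continuous_on (closed_simplex s) \<phi>"
    proof (rule continuous_on_coordinatewise_then_product)
      fix j
      have "continuous_on (closed_simplex s) (\<lambda>x. (S x - (m x)\<^sup>2) / (S x + (m x)\<^sup>2))"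
        "continuous_on (closed_simplex s) (\<lambda>x. 2 * m x * W x j / (S x + (m x)\<^sup>2))"
        by (intro continuous_intros cm cW cS D')+
      then show "continuous_on (closed_simplex s) (\<lambda>x. \<phi> x j)"
        unfolding \<phi>_def by (cases "j = 0"; cases "j < n") auto
    qed
    fix x assume x: "x \<in> closed_simplex s"
    show "\<phi> x \<in> topspace (nsphere (card s - 1))"
    proof -
      have "(\<Sum>i\<in>{1..<n}. (\<phi> x i)\<^sup>2) = (\<Sum>i\<in>{1..<n}. (2 * m x / (S x + (m x)\<^sup>2))\<^sup>2 * (W x i)\<^sup>2)"
        by (rule sum.cong) (auto simp: \<phi>_def power_mult_distrib power_divide)
      also have "\<dots> = (2 * m x / (S x + (m x)\<^sup>2))\<^sup>2 * S x" by (simp add: S_def sum_distrib_left)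
      finally have "(\<Sum>i\<le>n - 1. (\<phi> x i)\<^sup>2) = ((S x - (m x)\<^sup>2) / (S x + (m x)\<^sup>2))\<^sup>2 + (2 * m x / (S x + (m x)\<^sup>2))\<^sup>2 * S x"
        unfolding split by (simp add: \<phi>_def)
      also have "\<dots> = ((S x - (m x)\<^sup>2)\<^sup>2 + (2 * m x)\<^sup>2 * S x) / (S x + (m x)\<^sup>2)\<^sup>2"
        by (simp add: power_divide add_divide_distrib)
      also have "(S x - (m x)\<^sup>2)\<^sup>2 + (2 * m x)\<^sup>2 * S x = (S x + (m x)\<^sup>2)\<^sup>2"
        by (simp add: power2_eq_square algebra_simps)
      finally have "(\<Sum>i\<le>n - 1. (\<phi> x i)\<^sup>2) = 1" using D[OF x] by simp
      moreover have "\<phi> x i = 0" if "i > n - 1" for i using that by (auto simp: \<phi>_def)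
      ultimately show ?thesis by (simp add: nsphere n_def)
    qed
    show "\<phi> x = sphere_base \<longleftrightarrow> {v. x v \<noteq> 0} \<noteq> s"
    proof -
      have "\<phi> x = sphere_base \<longleftrightarrow> m x = 0"
      proof
        assume "\<phi> x = sphere_base"
        then have "\<phi> x 0 = 1" by (simp add: sphere_base_def)
        then show "m x = 0" using one_minus[OF x] D[OF x] by simp
      next
        assume "m x = 0"
        then show "\<phi> x = sphere_base" using D[OF x] by (auto simp: \<phi>_def sphere_base_def fun_eq_iff)
      qed
      then show ?thesis using m_pos[OF x] m_nonneg[OF x] by auto
    qed
    fix y assume y: "y \<in> closed_simplex s" and supp: "{v. x v \<noteq> 0} = s" "{v. y v \<noteq> 0} = s"
      and eq: "\<phi> x = \<phi> y"
    \<comment> \<open>\<open>\<phi>\<close> is inverse stereographic projection of the vector \<open>W / m\<close>.\<close>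
    have pos: "m x > 0" "m y > 0" using m_pos x y supp by auto
    have *: "W u j / m u = \<phi> u j / (1 - \<phi> u 0)" if "u \<in> closed_simplex s" "m u > 0" "j \<in> {1..<n}" for u j
    proof -
      have "\<phi> u j = 2 * m u * W u j / (S u + (m u)\<^sup>2)" using that(3) by (simp add: \<phi>_def)
      then show ?thesis using that(2) D[OF that(1)] unfolding one_minus[OF that(1)]
        by (simp add: power2_eq_square)
    qed
    have rat1: "W x j / m x = W y j / m y" if "j \<in> {1..<n}" for j
      using *[OF x pos(1) that] *[OF y pos(2) that] eq by simp
    have "W x 0 / m x = - (\<Sum>j\<in>{1..<n}. W x j / m x)" using W_sum[OF x] by (simp add: sum_divide_distrib)
    also have "\<dots> = - (\<Sum>j\<in>{1..<n}. W y j / m y)" using rat1 by simp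
    also have "\<dots> = W y 0 / m y" using W_sum[OF y] by (simp add: sum_divide_distrib)
    finally have rat: "W x j / m x = W y j / m y" if "j < n" for j
      using rat1[of j] that by (cases "j = 0") auto
    \<comment> \<open>The ratios \<open>W / m\<close> determine \<open>m\<close>: at an index where
      \<open>v\<close> attains its minimum, the inequality \<open>m_le\<close> for \<open>u\<close>
      is compared with the equality for \<open>v\<close>.\<close>
    have le: "m u \<le> m v" if "m u > 0" "m v > 0" and r: "\<And>j. j < n \<Longrightarrow> W u j / m u = W v j / m v" for u v
    proof -
      obtain j where j: "j < n" "m v - 1 = n * W v j" using m_att by metis
      have "(m u - 1) * m v \<le> n * W u j * m v" using m_le[OF j(1), of u] that(2) by (simp add: mult_right_mono)
      also have "\<dots> = n * W v j * m u" using r[OF j(1)] that(1,2) by (simp add: field_simps)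
      also have "\<dots> = (m v - 1) * m u" using j(2) by simp
      finally show ?thesis by (simp add: algebra_simps)
    qed
    have "m x = m y" using le[of x y] le[of y x] pos rat by fastforce
    then show "x = y" using W_ext[OF x y] rat pos by simp
  next
    fix p assume p: "p \<in> topspace (nsphere (card s - 1))" "p \<noteq> sphere_base"
    have p_sum: "(p 0)\<^sup>2 + (\<Sum>i\<in>{1..<n}. (p i)\<^sup>2) = 1" and p_out: "\<And>i. i \<ge> n \<Longrightarrow> p i = 0"
      using p(1) n unfolding nsphere n_def[symmetric] split by auto
    have nonneg: "0 \<le> (\<Sum>i\<in>{1..<n}. (p i)\<^sup>2)" by (intro sum_nonneg) auto
    have p0: "p 0 < 1"
    proof (rule ccontr)
      assume "\<not> p 0 < 1"
      then have "1 \<le> (p 0)\<^sup>2" by simp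
      then have "(\<Sum>i\<in>{1..<n}. (p i)\<^sup>2) = 0" and p00: "(p 0)\<^sup>2 = 1" using p_sum nonneg by linarith+
      then have "p i = 0" if "i \<in> {1..<n}" for i using that by (simp add: sum_nonneg_eq_0_iff)
      then have "p i = 0" if "i \<noteq> 0" for i using p_out[of i] that by (cases "i < n") auto
      moreover have "p 0 = 1" using p00 \<open>\<not> p 0 < 1\<close> by (auto simp: power2_eq_1_iff)
      ultimately have "p i = sphere_base i" for i by (cases "i = 0") (simp_all add: sphere_base_def)
      then show False using p(2) by auto
    qed
    \<comment> \<open>Stereographic projection of \<open>p\<close> from the base point. Coordinate 0
      is chosen to make the sum 0, as for displacements within the simplex.\<close>
    define u where "u j = (if j = 0 then - (\<Sum>i\<in>{1..<n}. p i / (1 - p 0)) else p j / (1 - p 0))" for j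
    have u_sum: "(\<Sum>j<n. u j) = 0" unfolding split by (simp add: u_def)
    define \<mu> where "\<mu> = Min (u ` {..<n})"
    have \<mu>_le: "\<mu> \<le> u j" if "j < n" for j using that by (simp add: \<mu>_def)
    have "\<mu> \<in> u ` {..<n}" unfolding \<mu>_def using n by (intro Min_in) auto
    then obtain j\<^sub>0 where j0: "j\<^sub>0 < n" "u j\<^sub>0 = \<mu>" by auto
    have "n * \<mu> \<le> (\<Sum>j<n. u j)" using sum_mono[of "{..<n}" "\<lambda>_. \<mu>" u] \<mu>_le by simp
    then have \<mu>: "n * \<mu> \<le> 0" using u_sum by simp
    \<comment> \<open>The preimage is sought as the barycentre plus \<open>M * u\<close>. Its scaled
      depth is \<open>1 + n * M * \<mu>\<close>, and setting this equal to \<open>M\<close> gives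
      the value.\<close>
    define M where "M = 1 / (1 - n * \<mu>)"
    have M: "M > 0" "M * (1 - n * \<mu>) = 1" using \<mu> by (auto simp: M_def)
    define x where "x v = (if v \<in> s then 1 / n + M * u (inv_into {..<n} e v) else 0)" for v
    have xe: "x (e j) = 1 / n + M * u j" if "j < n" for j
      using that e e_in by (simp add: x_def bij_betw_def)
    have min_val: "1 / n + M * \<mu> = M / n" using M n by (simp add: field_simps)
    have xe_ge: "M / n \<le> x v" if vs: "v \<in> s" for v
    proof -
      obtain j where j: "j < n" "v = e j" using e_ex[OF vs] by auto
      show ?thesis using xe[OF j(1)] \<mu>_le[OF j(1)] M(1) min_val j(2) by (metis add_left_mono mult_left_mono less_imp_le)
    qed
    have "x (e j\<^sub>0) = M / n" using xe[OF j0(1)] j0(2) min_val by simp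
    then have mx: "m x = M"
    proof -
      have "min_coord s x = M / n" unfolding min_coord_def
        by (rule Min_eqI) (use s xe_ge e_in[OF j0(1)] \<open>x (e j\<^sub>0) = M / n\<close> in \<open>auto intro: rev_image_eqI\<close>)
      then show ?thesis using n by (simp add: m_def)
    qed
    have M_n: "M / n > 0" using M n by simp
    have xs: "x \<in> closed_simplex s"
    proof -
      have "0 \<le> x v" for v using xe_ge[of v] M_n by (cases "v \<in> s") (auto simp: x_def)
      moreover have "(\<Sum>v\<in>s. x v) = 1"
      proof -
        have "(\<Sum>v\<in>s. x v) = (\<Sum>j<n. x (e j))" using sum.reindex_bij_betw[OF e, of x] by simp
        also have "\<dots> = (\<Sum>j<n. 1 / n + M * u j)" using xe by simp
        also have "\<dots> = 1 + M * (\<Sum>j<n. u j)" using n by (simp add: sum.distrib sum_distrib_left)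
        finally show ?thesis using u_sum by simp
      qed
      ultimately show ?thesis by (simp add: closed_simplex_def x_def)
    qed
    have supp: "{v. x v \<noteq> 0} = s" using m_pos[OF xs] mx M by simp
    have Wx: "W x j = M * u j" if "j < n" for j using xe[OF that] by (simp add: W_def)
    have Sx: "S x = M\<^sup>2 * ((1 + p 0) / (1 - p 0))"
    proof -
      have "S x = (\<Sum>j\<in>{1..<n}. (M / (1 - p 0))\<^sup>2 * (p j)\<^sup>2)"
        unfolding S_def by (rule sum.cong) (auto simp: Wx u_def power_mult_distrib power_divide)
      also have "\<dots> = (M / (1 - p 0))\<^sup>2 * (1 - (p 0)\<^sup>2)" using p_sum by (simp add: sum_distrib_left[symmetric])
      also have "\<dots> = M\<^sup>2 * ((1 + p 0) / (1 - p 0))" using p0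
        by (simp add: power2_eq_square divide_simps) (simp add: algebra_simps)
      finally show ?thesis .
    qed
    have Dx: "S x + (m x)\<^sup>2 = 2 * M\<^sup>2 / (1 - p 0)" unfolding Sx mx using p0 by (simp add: field_simps)
    have "\<phi> x j = p j" for j
    proof -
      consider "j = 0" | "j \<noteq> 0" "j < n" | "j \<noteq> 0" "j \<ge> n" by linarith
      then show ?thesis
      proof cases
        case 1
        have "1 - \<phi> x 0 = 1 - p 0" using one_minus[OF xs] M p0 unfolding Dx by (simp add: mx)
        then show ?thesis using 1 by simp
      next
        case 2
        then have "\<phi> x j = 2 * M * (M * (p j / (1 - p 0))) / (2 * M\<^sup>2 / (1 - p 0))"
          unfolding \<phi>_def Dx using Wx[of j] mx by (simp add: u_def)
        also have "\<dots> = p j" using M p0 by (simp add: power2_eq_square)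
        finally show ?thesis .
      next
        case 3
        then show ?thesis using p_out by (simp add: \<phi>_def)
      qed
    qed
    then show "\<exists>x\<in>closed_simplex s. {v. x v \<noteq> 0} = s \<and> \<phi> x = p"
      using xs supp by (intro bexI[of _ x]) auto
  qed
qed

section \<open>From facets to wedge summands\<close>

lemma Hausdorff_space_nsphere: "Hausdorff_space (nsphere n)"
  unfolding nsphere by (intro Hausdorff_space_subtopology) (simp add: Hausdorff_space_product_topology)

text \<open>The map \<open>q\<close> realizes the quotient by the contractible part: the interior of
  each facet in \<open>M\<close> fills its own sphere without the base point, and everything else
  goes to \<open>None\<close>.\<close>

lemma realization_homotopy_equivalent_wedge:
  fixes K :: "'v set set"
  assumes K: "simplicial_complex K" and M: "M \<subseteq> K" "{} \<notin> M" "M \<noteq> {}"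
    and facet: "\<And>s r. s \<in> M \<Longrightarrow> r \<in> K \<Longrightarrow> s \<subseteq> r \<Longrightarrow> r = s"
    and contr: "contractible (realization_set (K - M))" "realization_set (K - M) \<noteq> {}"
  shows "\<exists>k d. k > 0 \<and> top_of_set (realization_set K) homotopy_equivalent_space wedge_of_spheres k d"
proof -
  let ?R = "realization_set K" and ?T = "realization_set (K - M)"
  have finM: "finite M" using K M(1) finite_subset by (auto simp: simplicial_complex_def)
  have fin: "finite s" "s \<noteq> {}" "s \<in> K" if "s \<in> M" for s
    using that M simplicial_complexD(1)[OF K, of s] by auto
  define P where "P s \<phi> \<longleftrightarrow> continuous_on (closed_simplex s) \<phi>
    \<and> (\<forall>x\<in>closed_simplex s. \<phi> x \<in> topspace (nsphere (card s - 1)))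
    \<and> (\<forall>x\<in>closed_simplex s. \<phi> x = sphere_base \<longleftrightarrow> {v. x v \<noteq> 0} \<noteq> s)
    \<and> (\<forall>x\<in>closed_simplex s. \<forall>y\<in>closed_simplex s. {v. x v \<noteq> 0} = s \<longrightarrow> {v. y v \<noteq> 0} = s
        \<longrightarrow> \<phi> x = \<phi> y \<longrightarrow> x = y)
    \<and> (\<forall>p\<in>topspace (nsphere (card s - 1)). p \<noteq> sphere_base
        \<longrightarrow> (\<exists>x\<in>closed_simplex s. {v. x v \<noteq> 0} = s \<and> \<phi> x = p))"
    for s :: "'v set" and \<phi> :: "('v \<Rightarrow> real) \<Rightarrow> nat \<Rightarrow> real"
  have "\<forall>s\<in>M. \<exists>\<phi>. P s \<phi>"
  proof
    fix s assume "s \<in> M"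
    show "\<exists>\<phi>. P s \<phi>"
    proof (rule closed_simplex_to_sphere[OF fin(1,2)[OF \<open>s \<in> M\<close>]], intro exI)
      fix \<phi> :: "('v \<Rightarrow> real) \<Rightarrow> nat \<Rightarrow> real"
      assume "continuous_on (closed_simplex s) \<phi>"
        "\<And>x. x \<in> closed_simplex s \<Longrightarrow> \<phi> x \<in> topspace (nsphere (card s - 1))"
        "\<And>x. x \<in> closed_simplex s \<Longrightarrow> \<phi> x = sphere_base \<longleftrightarrow> {v. x v \<noteq> 0} \<noteq> s"
        "\<And>x y. x \<in> closed_simplex s \<Longrightarrow> y \<in> closed_simplex s \<Longrightarrow> {v. x v \<noteq> 0} = s \<Longrightarrow> {v. y v \<noteq> 0} = s
           \<Longrightarrow> \<phi> x = \<phi> y \<Longrightarrow> x = y"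
        "\<And>p. p \<in> topspace (nsphere (card s - 1)) \<Longrightarrow> p \<noteq> sphere_base
           \<Longrightarrow> \<exists>x\<in>closed_simplex s. {v. x v \<noteq> 0} = s \<and> \<phi> x = p"
      then show "P s \<phi>" unfolding P_def by (intro conjI ballI impI)
    qed
  qed
  then obtain \<phi> where \<phi>: "\<And>s. s \<in> M \<Longrightarrow> P s (\<phi> s)" by metis
  define k where "k = card M"
  have k: "k > 0" using finM M by (simp add: k_def card_gt_0_iff)
  obtain b where b: "bij_betw b {..<k} M"
    using ex_bij_betw_nat_finite[OF finM] by (auto simp: k_def atLeast0LessThan)
  define idx where "idx = inv_into {..<k} b"
  have b_in: "b i \<in> M" "idx (b i) = i" if "i < k" for i using b that by (auto simp: bij_betw_def idx_def)
  have idx: "idx s < k" "b (idx s) = s" if "s \<in> M" for s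
  proof -
    have "s \<in> b ` {..<k}" using b that by (simp add: bij_betw_def)
    then show "idx s < k" "b (idx s) = s" unfolding idx_def
      using inv_into_into[of s b "{..<k}"] f_inv_into_f[of s b "{..<k}"] by auto
  qed
  \<comment> \<open>A facet with \<open>c\<close> vertices has dimension \<open>c - 1\<close>;
    facets in \<open>M\<close> are nonempty, so nothing is truncated. An isolated vertex yields a
    sphere of dimension 0.\<close>
  define d where "d i = card (b i) - 1" for i
  let ?W = "wedge_of_spheres k d" and ?p = "\<lambda>_::nat. sphere_base"
  let ?S = "sum_topology (\<lambda>i. nsphere (d i)) {..<k}"
  have topW: "topspace ?W = wedge_proj ?p ` topspace ?S"
    unfolding wedge_of_spheres_def topspace_wedge_topology ..
  have supp: "{v. x v \<noteq> 0} \<in> K" if "x \<in> ?R" for x using that by (simp add: realization_set_def)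
  have T_iff: "x \<in> ?T \<longleftrightarrow> x \<in> ?R \<and> {w. x w \<noteq> 0} \<notin> M" for x by (auto simp: realization_set_def)
  define q where "q x = (if {v. x v \<noteq> 0} \<in> M
    then Some (idx {v. x v \<noteq> 0}, \<phi> {v. x v \<noteq> 0} x) else None)" for x
  have supp_sub: "{v. x v \<noteq> 0} \<subseteq> s" if "x \<in> closed_simplex s" for x s
    using that by (auto simp: closed_simplex_def)
  \<comment> \<open>The formula persists on the boundary of \<open>s\<close>: a proper face of
    \<open>s\<close> is not maximal, hence not in \<open>M\<close>, and \<open>\<phi> s\<close>
    takes the base point there.\<close>
  have q_cell: "q x = wedge_proj ?p (idx s, \<phi> s x)" if s: "s \<in> M" and x: "x \<in> closed_simplex s" for s x
  proof -
    have base: "\<phi> s x = sphere_base \<longleftrightarrow> {v. x v \<noteq> 0} \<noteq> s" using \<phi>[OF s] x by (simp add: P_def)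
    show ?thesis
    proof (cases "{v. x v \<noteq> 0} = s")
      case True
      then show ?thesis using base s by (simp add: q_def wedge_proj_def)
    next
      case False
      then have "{v. x v \<noteq> 0} \<notin> M" using facet[OF _ fin(3)[OF s] supp_sub[OF x]] by auto
      then show ?thesis using base False by (simp add: q_def wedge_proj_def)
    qed
  qed
  have q_supp: "x \<in> closed_simplex {v. x v \<noteq> 0}" if "x \<in> ?R" for x
    using realization_in_closed_simplex[OF K that subset_refl] simplicial_complexD(1)[OF K supp[OF that]] .
  have None_in: "None \<in> topspace ?W"
  proof -
    have "(0, sphere_base) \<in> topspace ?S" using k sphere_base_in_nsphere by simp
    then have "wedge_proj ?p (0, sphere_base) \<in> topspace ?W" unfolding topW by (rule imageI)
    then show ?thesis by (simp add: wedge_proj_def)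
  qed
  have q_cont: "continuous_map (top_of_set ?R) ?W q"
  \<comment> \<open>The closed simplices form a finite closed cover. On one belonging to
    \<open>M\<close>, \<open>q\<close> factors through its sphere; on any other it is
    constant.\<close>
  proof (rule pasting_lemma_closed[where I = K and T = closed_simplex and f = "\<lambda>_. q"])
    show "finite K" using K by (simp add: simplicial_complex_def)
    fix r assume r: "r \<in> K"
    have sub: "closed_simplex r \<subseteq> ?R" by (rule closed_simplex_subset_realization[OF K r])
    show "closedin (top_of_set ?R) (closed_simplex r)"
      using closed_closed_simplex sub by (rule closed_subset[rotated])
    have "continuous_map (top_of_set (closed_simplex r)) ?W q"
    proof (cases "r \<in> M")
      case True
      have "continuous_map (top_of_set (closed_simplex r)) (nsphere (d (idx r))) (\<phi> r)"
        using \<phi>[OF True] idx[OF True]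
        by (auto simp: P_def nsphere continuous_map_in_subtopology d_def euclidean_product_topology)
      moreover have "continuous_map (nsphere (d (idx r))) ?S (\<lambda>x. (idx r, x))"
        using continuous_map_component_injection[of "idx r" "{..<k}" "\<lambda>i. nsphere (d i)"] idx[OF True] by simp
      moreover have "continuous_map ?S ?W (wedge_proj ?p)"
        unfolding wedge_of_spheres_def by (rule quotient_imp_continuous_map[OF quotient_map_wedge_proj])
      ultimately have "continuous_map (top_of_set (closed_simplex r)) ?W (wedge_proj ?p \<circ> ((\<lambda>x. (idx r, x)) \<circ> \<phi> r))"
        by (intro continuous_map_compose)
      then show ?thesis
        by (rule continuous_map_eq) (use q_cell[OF True] in auto)
    next
      case False
      have None: "q x = None" if "x \<in> closed_simplex r" for x
      proof -
        have "{v. x v \<noteq> 0} \<notin> M" using facet[OF _ r supp_sub[OF that]] False by auto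
        then show ?thesis by (simp add: q_def)
      qed
      have "continuous_map (top_of_set (closed_simplex r)) ?W (\<lambda>_. None)"
        using None_in by simp
      then show ?thesis by (rule continuous_map_eq) (simp add: None)
    qed
    then show "continuous_map (subtopology (top_of_set ?R) (closed_simplex r)) ?W q"
      using sub by (simp add: subtopology_subtopology inf.absorb2)
  next
    fix x assume "x \<in> topspace (top_of_set ?R)"
    then show "\<exists>r. r \<in> K \<and> x \<in> closed_simplex r \<and> q x = q x"
      using supp q_supp by auto
  qed simp
  obtain h a where h: "continuous_on ({0..1} \<times> ?R) h"
    "\<And>t x. t \<in> {0..1} \<Longrightarrow> x \<in> ?R \<Longrightarrow> h (t, x) \<in> ?R"
    "\<And>x. x \<in> ?R \<Longrightarrow> h (0::real, x) = x"
    "\<And>t x. t \<in> {0..1} \<Longrightarrow> x \<in> ?T \<Longrightarrow> h (t, x) \<in> ?T"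
    "\<And>x. x \<in> ?T \<Longrightarrow> h (1, x) = a"
    by (rule realization_extend_contraction[OF K M(1,2) _ contr(1)]) (erule (2) facet, rule that)
  have "top_of_set ?R homotopy_equivalent_space ?W"
  proof (rule homotopy_equivalent_space_collapse[where A = ?T and h = h])
    show "compact_space (top_of_set ?R)"
      using compact_realization_set[OF K] by (simp add: compact_space_subtopology)
    show "Hausdorff_space ?W" unfolding wedge_of_spheres_def
      by (intro Hausdorff_space_wedge_topology Hausdorff_space_nsphere sphere_base_in_nsphere)
    show "continuous_map (top_of_set ?R) ?W q" by fact
    show "q ` topspace (top_of_set ?R) = topspace ?W"
    proof
      show "q ` topspace (top_of_set ?R) \<subseteq> topspace ?W"
        using q_cont by (rule continuous_map_image_subset_topspace)
      show "topspace ?W \<subseteq> q ` topspace (top_of_set ?R)"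
      proof
        fix y assume "y \<in> topspace ?W"
        then obtain i p where i: "i < k" and p: "p \<in> topspace (nsphere (d i))" and y: "y = wedge_proj ?p (i, p)"
          unfolding topW by auto
        show "y \<in> q ` topspace (top_of_set ?R)"
        proof (cases "p = sphere_base")
          case True
          \<comment> \<open>The base point is reached from the nonempty contractible part, since the
            boundary of a facet can be empty.\<close>
          obtain x where x: "x \<in> ?T" using contr(2) by auto
          then have "q x = y" using True y T_iff by (simp add: q_def wedge_proj_def)
          then show ?thesis using x T_iff by auto
        next
          case False
          have "\<exists>x\<in>closed_simplex (b i). {v. x v \<noteq> 0} = b i \<and> \<phi> (b i) x = p"
            using \<phi>[OF b_in(1)[OF i]] p False by (simp add: P_def d_def)
          then obtain x where x: "x \<in> closed_simplex (b i)" "\<phi> (b i) x = p" by auto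
          then have "q x = y" using q_cell[OF b_in(1)[OF i] x(1)] b_in(2)[OF i] y by simp
          moreover have "x \<in> ?R"
            using closed_simplex_subset_realization[OF K fin(3)[OF b_in(1)[OF i]]] x by auto
          ultimately show ?thesis by auto
        qed
      qed
    qed
    show "?T \<subseteq> topspace (top_of_set ?R)" using T_iff by auto
    show "q x = q y" if "x \<in> ?T" "y \<in> ?T" for x y using that T_iff by (simp add: q_def)
    show "x = y \<or> x \<in> ?T \<and> y \<in> ?T"
      if xy: "x \<in> topspace (top_of_set ?R)" "y \<in> topspace (top_of_set ?R)" and eq: "q x = q y" for x y
    proof (cases "{v. x v \<noteq> 0} \<in> M")
      case True
      have R: "x \<in> ?R" "y \<in> ?R" using xy by auto
      have yM: "{v. y v \<noteq> 0} \<in> M" using eq True by (auto simp: q_def split: if_splits)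
      have "idx {v. x v \<noteq> 0} = idx {v. y v \<noteq> 0}" and \<phi>_eq: "\<phi> {v. x v \<noteq> 0} x = \<phi> {v. y v \<noteq> 0} y"
        using eq True yM by (auto simp: q_def)
      then have "{v. x v \<noteq> 0} = {v. y v \<noteq> 0}" using idx(2)[OF True] idx(2)[OF yM] by metis
      then have "x = y"
        using \<phi>[OF True] q_supp[OF R(1)] q_supp[OF R(2)] \<phi>_eq unfolding P_def by metis
      then show ?thesis ..
    next
      case False
      then have "{v. y v \<noteq> 0} \<notin> M" using eq by (auto simp: q_def split: if_splits)
      then show ?thesis using False xy T_iff by simp
    qed
    show "continuous_map (prod_topology (top_of_set {0..1}) (top_of_set ?R)) (top_of_set ?R) h"
      using h(1,2) by (auto simp: continuous_map_subtopology_eu)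
    show "h (1, x) = h (1, y)" if "x \<in> ?T" "y \<in> ?T" for x y using h(5) that by simp
  qed (use h(3,4) in auto)
  then show ?thesis using k by auto
qed

lemma simplicial_complex_bounded_degree_complex:
  assumes "forest_graph V E"
  shows "simplicial_complex (bounded_degree_complex V E lam)"
proof -
  have "finite V" "E \<subseteq> Pow V" using assms by (auto simp: forest_graph_def simple_graph_def)
  then have E: "finite E" using finite_subset by blast
  have "bounded_degree_complex V E lam \<subseteq> Pow E" by (auto simp: bounded_degree_complex_def)
  then show ?thesis
    using E bounded_degree_complex_subset[OF E] finite_subset
    unfolding simplicial_complex_def by (meson PowD finite_Pow_iff subsetD)
qed

theorem theorem1p3:
  fixes V :: "'a set" and E :: "'a set set" and lam :: "'a \<Rightarrow> nat"
  assumes "forest_graph V E"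
  shows "nonempty_contractible_space (geometric_realization (bounded_degree_complex V E lam)) \<or>
         homotopy_equivalent_wedge_of_spheres (geometric_realization (bounded_degree_complex V E lam))"
proof -
  let ?K = "bounded_degree_complex V E lam"
  have K: "simplicial_complex ?K" by (rule simplicial_complex_bounded_degree_complex[OF assms])
  obtain M where M: "M \<subseteq> ?K" and facet: "\<forall>s\<in>M. \<forall>r\<in>?K. s \<subseteq> r \<longrightarrow> r = s" and col: "collapsible (?K - M)"
    using facet_collapsible_bounded_degree_complex[OF assms, of lam] unfolding facet_collapsible_def by auto
  have empty: "{} \<in> ?K" by (simp add: bounded_degree_complex_def edge_degree_def)
  show ?thesis
  proof (cases "{} \<in> M")
    case True
    \<comment> \<open>A maximal empty face is the only face, so the realization is empty, the sphere
      of dimension -1.\<close>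
    then have "?K = {{}}" using facet empty by auto
    then have "realization_set ?K = {}" by (auto simp: realization_set_def)
    then have "geometric_realization ?K = trivial_topology"
      by (simp add: geometric_realization_eq)
    then have "geometric_realization ?K homotopy_equivalent_space (trivial_topology :: (nat \<Rightarrow> real) topology)"
      by (simp add: homeomorphic_imp_homotopy_equivalent_space homeomorphic_empty_space_eq)
    then show ?thesis by (simp add: homotopy_equivalent_wedge_of_spheres_def)
  next
    case False
    have "simplicial_complex (?K - M)"
      by (rule simplicial_complex_Diff_facets[OF K]) (use facet in auto)
    \<comment> \<open>The empty face remains in \<open>?K - M\<close>, which excludes the void
      complex.\<close>
    then have T: "contractible (realization_set (?K - M))" "realization_set (?K - M) \<noteq> {}"
      using contractible_realization_of_collapsible[OF col] empty False by auto
    show ?thesis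
    proof (cases "M = {}")
      case True
      then show ?thesis using T by (simp add: nonempty_contractible_space_def geometric_realization_eq)
    next
      case ne: False
      have "\<exists>k d. k > 0 \<and> top_of_set (realization_set ?K) homotopy_equivalent_space wedge_of_spheres k d"
        by (rule realization_homotopy_equivalent_wedge[OF K M False ne _ T]) (use facet in auto)
      then show ?thesis by (simp add: homotopy_equivalent_wedge_of_spheres_def geometric_realization_eq)
    qed
  qed
qed

end
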